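(* Let $m>0$ and let $(M,g)$ be the Riemannian Schwarzschild manifold of mass $m$. Let $\Sigma_0=\{x\in M: x_3=0\}$ be the plane through the origin. Then the Morse index of $\Sigma_0$, with respect to variations that are tangential along $\partial M$, is exactly one.
   Context: For $m>0$ let $M=\{x\in\mathbb R^3: |x|\ge m/2\}$ with metric $g=(1+\frac{m}{2|x|})^4\delta$, $\delta$ the Euclidean metric; $\partial M=\{|x|=m/2\}$ is the horizon. $\Sigma_0$ is a totally geodesic free-boundary minimal surface (a topological annulus) meeting $\partial M$ orthogonally; any rotation of it is also called a plane through the origin. For a properly embedded free-boundary minimal surface $\Sigma$ with global unit normal $N$, define for smooth $u$ on $\Sigma$ $$Q(u,u)=\int_\Sigma\big(|\nabla_g u|_g^2-(\mathrm{Ric}_g(N,N)+|A_\Sigma|_g^2)u^2\big)\,dA_g+\int_{\partial\Sigma}A_{\partial M}(N,N)u^2\,ds_g,$$ where $A_\Sigma(V,W)=-g(\tilde\nabla_V N,W)$, $A_{\partial M}(V,W)=-g(\tilde\nabla_V\eta,W)$ with $\eta$ the outward unit normal of $\partial M$ and $\tilde\nabla$ the Levi-Civita connection of $g$. For $R>m/2$ let $\Sigma(R)=\Sigma\cap\{|x|\le R\}$ ($|x|$ Euclidean norm). The Morse index of $\Sigma(R)$ is the maximal dimension of a linear space $V$ of smooth functions on $\Sigma(R)$ vanishing on $\{|x|=R\}$ with $Q(u,u)<0$ for all $u\in V\setminus\{0\}$ (no condition is imposed on $\partial\Sigma\subset\partial M$). The Morse index of $\Sigma$ is the limit of the indices of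 $\Sigma(R)$ as $R\to\infty$. *)

theory Defs
  imports "HOL-Analysis.Analysis"
begin

definition pd :: "(real^'n \<Rightarrow> real) \<Rightarrow> 'n \<Rightarrow> real^'n \<Rightarrow> real" where
  "pd f k x = deriv (\<lambda>t. f (x + t *\<^sub>R axis k 1)) 0"

fun pdl :: "'n list \<Rightarrow> (real^'n \<Rightarrow> real) \<Rightarrow> real^'n \<Rightarrow> real" where
  "pdl [] f = f"
| "pdl (k # ks) f = pd (pdl ks f) k"

definition smooth_on :: "(real^'n) set \<Rightarrow> (real^'n \<Rightarrow> real) \<Rightarrow> bool" where
  "smooth_on S f \<longleftrightarrow> open S \<and> (\<forall>ks. \<forall>x\<in>S. pdl ks f differentiable (at x))"

type_synonym metric3 = "real^3 \<Rightarrow> real^3^3"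

definition ginner :: "metric3 \<Rightarrow> real^3 \<Rightarrow> real^3 \<Rightarrow> real^3 \<Rightarrow> real" where
  "ginner G x V W = (\<Sum>i\<in>UNIV. \<Sum>j\<in>UNIV. V$i * (G x)$i$j * W$j)"

definition christoffel :: "metric3 \<Rightarrow> 3 \<Rightarrow> 3 \<Rightarrow> 3 \<Rightarrow> real^3 \<Rightarrow> real" where
  "christoffel G k i j x = (1/2) * (\<Sum>l\<in>UNIV. (matrix_inv (G x))$k$l *
      (pd (\<lambda>y. (G y)$j$l) i x + pd (\<lambda>y. (G y)$i$l) j x - pd (\<lambda>y. (G y)$i$j) l x))"

text \<open>Ricci tensor components Ric_jk = R^i_ijk with
  R^l_ijk = d_i Gamma^l_jk - d_j Gamma^l_ik + Gamma^l_ip Gamma^p_jk - Gamma^l_jp Gamma^p_ik.\<close>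
definition ricci_comp :: "metric3 \<Rightarrow> 3 \<Rightarrow> 3 \<Rightarrow> real^3 \<Rightarrow> real" where
  "ricci_comp G j k x = (\<Sum>i\<in>UNIV.
      pd (\<lambda>y. christoffel G i j k y) i x - pd (\<lambda>y. christoffel G i i k y) j x
      + (\<Sum>p\<in>UNIV. christoffel G i i p x * christoffel G p j k x
                   - christoffel G i j p x * christoffel G p i k x))"

definition ricci :: "metric3 \<Rightarrow> real^3 \<Rightarrow> real^3 \<Rightarrow> real^3 \<Rightarrow> real" where
  "ricci G x V W = (\<Sum>j\<in>UNIV. \<Sum>k\<in>UNIV. V$j * W$k * ricci_comp G j k x)"

definition covd :: "metric3 \<Rightarrow> (real^3 \<Rightarrow> real^3) \<Rightarrow> real^3 \<Rightarrow> real^3 \<Rightarrow> real^3" where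
  "covd G Y V x = (\<chi> k. (\<Sum>i\<in>UNIV. V$i * pd (\<lambda>y. (Y y)$k) i x)
      + (\<Sum>i\<in>UNIV. \<Sum>j\<in>UNIV. christoffel G k i j x * V$i * (Y x)$j))"

definition sff :: "metric3 \<Rightarrow> (real^3 \<Rightarrow> real^3) \<Rightarrow> real^3 \<Rightarrow> real^3 \<Rightarrow> real^3 \<Rightarrow> real" where
  "sff G Nf x V W = - ginner G x (covd G Nf V x) W"

text \<open>g-unit normal field of a level set of a function with Euclidean gradient D:
  the g-gradient G^{-1} D normalised.\<close>
definition unit_normal_of :: "metric3 \<Rightarrow> (real^3 \<Rightarrow> real^3) \<Rightarrow> real^3 \<Rightarrow> real^3" where
  "unit_normal_of G D y = (let v = matrix_inv (G y) *v D y in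
      (1 / sqrt (ginner G y v v)) *\<^sub>R v)"

definition schw :: "real \<Rightarrow> metric3" where
  "schw m x = (\<chi> i j. (1 + m / (2 * norm x)) ^ 4 * (if i = j then 1 else 0))"

text \<open>Outward unit normal eta of M = {|x| \<ge> m/2} along the horizon: it points towards
  decreasing |x|, i.e. it is the g-unit normal field of the spheres |x| = const built from
  the Euclidean gradient of -|x|.\<close>
definition horizon_normal :: "real \<Rightarrow> real^3 \<Rightarrow> real^3" where
  "horizon_normal m = unit_normal_of (schw m) (\<lambda>y. - ((1 / norm y) *\<^sub>R y))"

definition plane_emb :: "real^2 \<Rightarrow> real^3" where
  "plane_emb p = vector [p$1, p$2, 0]"

definition plane_tan :: "2 \<Rightarrow> real^3" where
  "plane_tan a = plane_emb (axis a 1)"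

definition plane_normal :: "real \<Rightarrow> real^3 \<Rightarrow> real^3" where
  "plane_normal m = unit_normal_of (schw m) (\<lambda>y. axis 3 1)"

definition ind_metric :: "real \<Rightarrow> real^2 \<Rightarrow> real^2^2" where
  "ind_metric m p = (\<chi> a b. ginner (schw m) (plane_emb p) (plane_tan a) (plane_tan b))"

definition ind_inv :: "real \<Rightarrow> real^2 \<Rightarrow> real^2^2" where
  "ind_inv m p = matrix_inv (ind_metric m p)"

definition area_elt :: "real \<Rightarrow> real^2 \<Rightarrow> real" where
  "area_elt m p = sqrt (det (ind_metric m p))"

definition grad_sq :: "real \<Rightarrow> (real^2 \<Rightarrow> real) \<Rightarrow> real^2 \<Rightarrow> real" where
  "grad_sq m u p = (\<Sum>a\<in>UNIV. \<Sum>b\<in>UNIV. (ind_inv m p)$a$b * pd u a p * pd u b p)"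

definition plane_A :: "real \<Rightarrow> real^2 \<Rightarrow> real^3 \<Rightarrow> real^3 \<Rightarrow> real" where
  "plane_A m p V W = sff (schw m) (plane_normal m) (plane_emb p) V W"

definition plane_A_sq :: "real \<Rightarrow> real^2 \<Rightarrow> real" where
  "plane_A_sq m p = (\<Sum>a\<in>UNIV. \<Sum>b\<in>UNIV. \<Sum>c\<in>UNIV. \<Sum>d\<in>UNIV.
      (ind_inv m p)$a$c * (ind_inv m p)$b$d
      * plane_A m p (plane_tan a) (plane_tan b) * plane_A m p (plane_tan c) (plane_tan d))"

definition bcurve :: "real \<Rightarrow> real \<Rightarrow> real^2" where
  "bcurve m \<theta> = vector [m / 2 * cos \<theta>, m / 2 * sin \<theta>]"

definition bspeed :: "real \<Rightarrow> real \<Rightarrow> real" where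
  "bspeed m \<theta> = (let v = plane_emb (vector_derivative (bcurve m) (at \<theta>)) in
      sqrt (ginner (schw m) (plane_emb (bcurve m \<theta>)) v v))"

definition plane_dom :: "real \<Rightarrow> real \<Rightarrow> (real^2) set" where
  "plane_dom m R = {p. m / 2 \<le> norm p \<and> norm p \<le> R}"

definition indexQ :: "real \<Rightarrow> real \<Rightarrow> (real^2 \<Rightarrow> real) \<Rightarrow> real" where
  "indexQ m R u =
     integral (plane_dom m R) (\<lambda>p.
        (grad_sq m u p
         - (ricci (schw m) (plane_emb p) (plane_normal m (plane_emb p)) (plane_normal m (plane_emb p))
            + plane_A_sq m p) * (u p)\<^sup>2) * area_elt m p)
   + integral {0..2*pi} (\<lambda>\<theta>.
        sff (schw m) (horizon_normal m) (plane_emb (bcurve m \<theta>))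
            (plane_normal m (plane_emb (bcurve m \<theta>))) (plane_normal m (plane_emb (bcurve m \<theta>)))
        * (u (bcurve m \<theta>))\<^sup>2 * bspeed m \<theta>)"

definition admissible :: "real \<Rightarrow> real \<Rightarrow> (real^2 \<Rightarrow> real) \<Rightarrow> bool" where
  "admissible m R u \<longleftrightarrow> (\<exists>S. plane_dom m R \<subseteq> S \<and> smooth_on S u)
      \<and> (\<forall>p. norm p = R \<longrightarrow> u p = 0)"

text \<open>Morse index of Sigma_0(R): the supremum of the dimensions k of spaces spanned by
  admissible u_0..u_{k-1} on which Q is negative definite (negativity on all nonzero
  combinations forces the u_i to be linearly independent on Sigma_0(R)).\<close>
definition morse_index_R :: "real \<Rightarrow> real \<Rightarrow> enat" where
  "morse_index_R m R = Sup {enat k | k. \<exists>us :: nat \<Rightarrow> real^2 \<Rightarrow> real.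
      (\<forall>i<k. admissible m R (us i)) \<and>
      (\<forall>c :: nat \<Rightarrow> real. (\<exists>i<k. c i \<noteq> 0) \<longrightarrow>
          indexQ m R (\<lambda>p. \<Sum>i<k. c i * us i p) < 0)}"

end

theory Submission
  imports Defs
begin

text \<open>At the free end r = m/2 nothing is prescribed, so a Riccati comparison reaching the
  horizon needs a variable that is nonpositive there. The explicit radial Jacobi field
  \<open>(r - m/2) / (r + m/2)\<close> vanishes at the horizon and its Riccati variable blows up to
  plus infinity. Hence the interval is cut: the Jacobi field serves outside r = m, an affine
  subsolution inside, and the linear constraint removes the boundary terms at the cut.

  On circles the sharp Poincare constant is 1, but 1/2 is enough because
  \<open>2 * m * r \<le> (r + m/2)\<^sup>2\<close>. This slack replaces Fourier series by a
  comparison function: \<open>cos (t / sqrt 2)\<close> has no zero on the closed interval of length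
  pi centred at 0, whereas \<open>cos t\<close> vanishes at both ends.

  The Dirichlet energy in dimension two is invariant under scaling, so a rescaled cutoff profile
  does not become cheaper as R grows. Its shape therefore has to be chosen so that its fixed energy
  lies below the total potential.\<close>

text \<open>The plane and the horizon are totally geodesic, and conformal invariance of the Dirichlet energy
  turns the form into
  \<open>Q(u,u) = \<integral> |\<nabla>u|\<^sup>2 - m / (r (r + m/2)\<^sup>2) u\<^sup>2 dx\<close>
  over a Euclidean annulus, without boundary term. On each circle the potential is at most
  \<open>1 / (2 r\<^sup>2)\<close>, so the Poincare inequality on the circle shows that only the radial mean of \<open>u\<close> can
  contribute negatively. If this mean vanishes at \<open>r = m\<close>, the one-dimensional form is nonnegative on
  \<open>[m/2, m]\<close> and on \<open>[m, R]\<close> by a Riccati comparison. Hence a space on which \<open>Q\<close> is negative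
  definite has dimension at most one, and \<open>(R\<^sup>2 - |x|\<^sup>2)\<^sup>2\<close> spans such a line for large \<open>R\<close>.\<close>

subsection \<open>Curvature of the Schwarzschild metric along the plane\<close>

lemma pd_eqI:
  assumes "((\<lambda>t. f (x + t *\<^sub>R axis k 1)) has_real_derivative D) (at 0)"
  shows "pd f k x = D"
  unfolding pd_def using assms by (rule DERIV_imp_deriv)

lemma eventually_shift_axis:
  fixes x :: "real^'n"
  assumes "open S" "x \<in> S"
  shows "eventually (\<lambda>t. x + t *\<^sub>R axis k 1 \<in> S) (nhds 0)"
proof -
  have "((\<lambda>t. x + t *\<^sub>R axis k 1) \<longlongrightarrow> x + 0 *\<^sub>R axis k 1) (nhds (0::real))"
    by (intro tendsto_intros filterlim_ident)
  then show ?thesis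
    using assms by (simp add: topological_tendstoD)
qed

text \<open>The closed formulas for the metric quantities hold only off the origin. A partial
  derivative sees only a neighbourhood, so they may be substituted on the open set
  \<open>- {0}\<close>.\<close>

lemma pd_cong_open:
  assumes "open S" "x \<in> S" "\<And>y. y \<in> S \<Longrightarrow> f y = g y"
  shows "pd f k x = pd g k x"
  unfolding pd_def
proof (rule deriv_cong_ev)
  show "\<forall>\<^sub>F t in nhds 0. f (x + t *\<^sub>R axis k 1) = g (x + t *\<^sub>R axis k 1)"
    using eventually_shift_axis[OF assms(1,2)] by (rule eventually_mono) (rule assms(3))
qed simp

lemma norm_has_real_derivative_axis:
  fixes x :: "real^'n"
  assumes "x \<noteq> 0"
  shows "((\<lambda>t. norm (x + t *\<^sub>R axis k 1)) has_real_derivative x$k / norm x) (at 0)"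
proof -
  have "((\<lambda>t. x + t *\<^sub>R axis k (1::real)) has_derivative (\<lambda>t. t *\<^sub>R axis k 1)) (at 0)"
    by (auto intro!: derivative_eq_intros)
  moreover have "(norm has_derivative (\<lambda>z. z \<bullet> sgn x)) (at (x + 0 *\<^sub>R axis k (1::real)))"
    using has_derivative_norm[OF assms] by simp
  ultimately have "(norm \<circ> (\<lambda>t. x + t *\<^sub>R axis k (1::real)) has_derivative
      (\<lambda>z. z \<bullet> sgn x) \<circ> (\<lambda>t. t *\<^sub>R axis k 1)) (at 0)"
    by (rule diff_chain_at)
  then have "((\<lambda>t. norm (x + t *\<^sub>R axis k (1::real))) has_derivative (\<lambda>t. (t *\<^sub>R axis k 1) \<bullet> sgn x)) (at 0)"
    by (simp add: o_def)
  then show ?thesis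
    unfolding has_field_derivative_def
    by (rule has_derivative_eq_rhs)
      (auto simp: fun_eq_iff sgn_div_norm inner_axis' divide_inverse)
qed

lemma component_has_real_derivative_axis:
  fixes x :: "real^'n"
  shows "((\<lambda>t. (x + t *\<^sub>R axis k 1)$j) has_real_derivative (if j = k then 1 else 0)) (at 0)"
  by (auto intro!: derivative_eq_intros simp: axis_def)

lemma radial_has_real_derivative_axis:
  fixes x :: "real^'n"
  assumes "x \<noteq> 0" "(F has_real_derivative D) (at (norm x))"
  shows "((\<lambda>t. F (norm (x + t *\<^sub>R axis k 1))) has_real_derivative D * (x$k / norm x)) (at 0)"
  using DERIV_chain2[where x=0, OF _ norm_has_real_derivative_axis[OF assms(1)]] assms(2) by simp

lemma matrix_inv_scalar:
  fixes c :: real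
  assumes "c \<noteq> 0"
  shows "matrix_inv (\<chi> i j. c * (if i = j then 1 else 0)) =
    (\<chi> i j. (1/c) * (if i = j then 1 else 0) :: real^'n^'n)" (is "matrix_inv ?A = ?B")
proof -
  have AB: "?A ** ?B = mat 1" "?B ** ?A = mat 1"
    using assms by (auto simp: matrix_matrix_mult_def mat_def vec_eq_iff
      if_distrib[of "\<lambda>z. z * _"] if_distrib[of "\<lambda>z. _ * z"] cong: if_cong)
  \<comment> \<open>\<open>matrix_inv\<close> is a Hilbert choice, so its defining equations need a
    witness; uniqueness of a two-sided inverse then identifies it.\<close>
  have "?A ** matrix_inv ?A = mat 1 \<and> matrix_inv ?A ** ?A = mat 1"
    unfolding matrix_inv_def using AB by (rule_tac someI[where x="?B"]) auto
  then have "matrix_inv ?A = (?B ** ?A) ** matrix_inv ?A"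
    using AB by simp
  also have "\<dots> = ?B"
    using \<open>?A ** matrix_inv ?A = mat 1 \<and> _\<close> by (simp add: matrix_mul_assoc[symmetric])
  finally show ?thesis .
qed

section \<open>Conformal factor, Christoffel symbols and Ricci curvature\<close>

definition confac :: "real \<Rightarrow> real \<Rightarrow> real" where
  "confac m r = (1 + m / (2 * r)) ^ 4"

lemma confac_pos: "m > 0 \<Longrightarrow> r > 0 \<Longrightarrow> confac m r > 0"
  unfolding confac_def by (intro zero_less_power add_pos_pos) auto

lemma confac_has_real_derivative:
  assumes "m > 0" "r > 0"
  shows "(confac m has_real_derivative - 2 * m / (r * (r + m/2)) * confac m r) (at r)"
proof -
  have "(confac m has_real_derivative 4 * (1 + m / (2 * r)) ^ 3 * (- m / (2 * r^2))) (at r)"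
    unfolding confac_def using assms
    by (auto intro!: derivative_eq_intros simp: power2_eq_square)
  moreover have "4 * (1 + m / (2 * r)) ^ 3 * (- m / (2 * r^2)) = - 2 * m / (r * (r + m/2)) * confac m r"
  proof -
    define w where "w = 1 + m / (2*r)"
    have "r + m/2 = r * w" "w > 0" "r \<noteq> 0" using assms by (auto simp: w_def field_simps add_pos_pos)
    then show ?thesis unfolding confac_def w_def[symmetric]
      by (simp add: field_simps power2_eq_square power3_eq_cube power4_eq_xxxx)
  qed
  ultimately show ?thesis by simp
qed

text \<open>If the metric is written as \<open>exp (2 * psi)\<close> times the Euclidean one, the
  Euclidean gradient of psi at x is \<open>chris_rad m (norm x)\<close> times x.\<close>

definition chris_rad :: "real \<Rightarrow> real \<Rightarrow> real" where
  "chris_rad m r = - m / (r^2 * (r + m/2))"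

lemma schw_nth: "schw m x $ i $ j = confac m (norm x) * (if i = j then 1 else 0)"
  by (simp add: schw_def confac_def)

lemma matrix_inv_schw:
  assumes "m > 0" "x \<noteq> 0"
  shows "matrix_inv (schw m x) = (\<chi> i j. (1 / confac m (norm x)) * (if i = j then 1 else 0))"
proof -
  have "schw m x = (\<chi> i j. confac m (norm x) * (if i = j then 1 else 0))"
    by (simp add: vec_eq_iff schw_nth)
  then show ?thesis
    using matrix_inv_scalar[of "confac m (norm x)"] confac_pos[of m "norm x"] assms by auto
qed

lemma pd_schw:
  assumes "m > 0" "x \<noteq> 0"
  shows "pd (\<lambda>y. schw m y $ i $ j) k x =
    (if i = j then 2 * confac m (norm x) * chris_rad m (norm x) * x$k else 0)"
proof -
  have "((\<lambda>t. confac m (norm (x + t *\<^sub>R axis k 1)) * (if i = j then 1 else 0)) has_real_derivative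
      (- 2 * m / (norm x * (norm x + m/2)) * confac m (norm x)) * (x$k / norm x) * (if i = j then 1 else 0)) (at 0)"
    using radial_has_real_derivative_axis[OF assms(2) confac_has_real_derivative[of m "norm x"]] assms
    by (intro DERIV_cmult_right) auto
  then have "pd (\<lambda>y. schw m y $ i $ j) k x =
      (- 2 * m / (norm x * (norm x + m/2)) * confac m (norm x)) * (x$k / norm x) * (if i = j then 1 else 0)"
    unfolding schw_nth by (rule pd_eqI)
  also have "\<dots> = (if i = j then 2 * confac m (norm x) * chris_rad m (norm x) * x$k else 0)"
    by (simp add: chris_rad_def power2_eq_square ac_simps)
  finally show ?thesis .
qed

text \<open>This is the conformal change formula over a flat background: the symbol is delta_jk d_i
  psi + delta_ik d_j psi - delta_ij d_k psi.\<close>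

lemma christoffel_schw:
  assumes "m > 0" "x \<noteq> 0"
  shows "christoffel (schw m) k i j x = chris_rad m (norm x) *
    ((if j = k then x$i else 0) + (if i = k then x$j else 0) - (if i = j then x$k else 0))"
proof -
  have c: "confac m (norm x) \<noteq> 0" using confac_pos[of m "norm x"] assms by auto
  have "christoffel (schw m) k i j x = (1/2) * (1 / confac m (norm x)) *
     (pd (\<lambda>y. schw m y $ j $ k) i x + pd (\<lambda>y. schw m y $ i $ k) j x - pd (\<lambda>y. schw m y $ i $ j) k x)"
    unfolding christoffel_def matrix_inv_schw[OF assms]
    by (simp add: if_distrib[of "\<lambda>c. c * _"] if_distrib[of "\<lambda>c. _ * c"] cong: if_cong)
  also have "\<dots> = chris_rad m (norm x) *
    ((if j = k then x$i else 0) + (if i = k then x$j else 0) - (if i = j then x$k else 0))"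
    unfolding pd_schw[OF assms] using c by (auto simp: field_simps)
  finally show ?thesis .
qed

definition chris_rad' :: "real \<Rightarrow> real \<Rightarrow> real" where
  "chris_rad' m r = m * (3 * r + m) / (r^3 * (r + m/2)^2)"

lemma chris_rad_has_real_derivative:
  assumes "m > 0" "r > 0"
  shows "(chris_rad m has_real_derivative chris_rad' m r) (at r)"
proof -
  have nz: "r \<noteq> 0" "r + m/2 \<noteq> 0" using assms by auto
  have "(chris_rad m has_real_derivative
      m * (2 * r * (r + m/2) + r^2) / (r^2 * (r + m/2))^2) (at r)"
    unfolding chris_rad_def using nz
    by (auto intro!: derivative_eq_intros simp: power2_eq_square)
  moreover have "m * (2 * r * (r + m/2) + r^2) / (r^2 * (r + m/2))^2 = chris_rad' m r"
  proof -
    have "2 * r * (r + m/2) + r^2 = r * (3 * r + m)"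
      by (simp add: algebra_simps power2_eq_square)
    then show ?thesis
      using nz(1) by (simp add: chris_rad'_def power2_eq_square power3_eq_cube)
  qed
  ultimately show ?thesis by simp
qed

lemma pd_christoffel_schw:
  assumes "m > 0" "x \<noteq> 0"
  shows "pd (christoffel (schw m) k i j) l x =
    chris_rad' m (norm x) * (x$l / norm x) *
      ((if j = k then x$i else 0) + (if i = k then x$j else 0) - (if i = j then x$k else 0)) +
    chris_rad m (norm x) *
      ((if j = k \<and> i = l then 1 else 0) + (if i = k \<and> j = l then 1 else 0) - (if i = j \<and> k = l then 1 else 0))"
proof -
  \<comment> \<open>Kronecker deltas written as factors 0 and 1 leave one product of a radial and a
    linear function to differentiate.\<close>
  have "pd (christoffel (schw m) k i j) l x = pd (\<lambda>y. chris_rad m (norm y) *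
      ((if j = k then 1 else 0) * y$i + (if i = k then 1 else 0) * y$j - (if i = j then 1 else 0) * y$k)) l x"
    by (rule pd_cong_open[of "- {0}"]) (use assms in \<open>auto simp: christoffel_schw\<close>)
  also have "\<dots> = chris_rad' m (norm x) * (x$l / norm x) *
      ((if j = k then 1 else 0) * x$i + (if i = k then 1 else 0) * x$j - (if i = j then 1 else 0) * x$k) +
    chris_rad m (norm x) *
      ((if j = k then 1 else 0) * (if i = l then 1 else 0) + (if i = k then 1 else 0) * (if j = l then 1 else 0)
       - (if i = j then 1 else 0) * (if k = l then 1 else 0))"
  proof (rule pd_eqI)
    note der = radial_has_real_derivative_axis[OF assms(2) chris_rad_has_real_derivative[OF assms(1)], of l]
      component_has_real_derivative_axis[of x l]
    show "((\<lambda>t. chris_rad m (norm (x + t *\<^sub>R axis l 1)) *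
      ((if j = k then 1 else 0) * (x + t *\<^sub>R axis l 1)$i + (if i = k then 1 else 0) * (x + t *\<^sub>R axis l 1)$j
        - (if i = j then 1 else 0) * (x + t *\<^sub>R axis l 1)$k)) has_real_derivative
      chris_rad' m (norm x) * (x$l / norm x) *
      ((if j = k then 1 else 0) * x$i + (if i = k then 1 else 0) * x$j - (if i = j then 1 else 0) * x$k) +
    chris_rad m (norm x) *
      ((if j = k then 1 else 0) * (if i = l then 1 else 0) + (if i = k then 1 else 0) * (if j = l then 1 else 0)
       - (if i = j then 1 else 0) * (if k = l then 1 else 0))) (at 0)"
      using DERIV_mult[OF der(1) DERIV_diff[OF DERIV_add[OF DERIV_cmult[OF der(2)[of i]]
            DERIV_cmult[OF der(2)[of j]]] DERIV_cmult[OF der(2)[of k]]],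
          of "if j = k then 1 else 0" "if i = k then 1 else 0" "if i = j then 1 else 0"]
      by (rule DERIV_cong) (use assms in \<open>simp_all add: mult.commute\<close>)
  qed
  also have "\<dots> = chris_rad' m (norm x) * (x$l / norm x) *
      ((if j = k then x$i else 0) + (if i = k then x$j else 0) - (if i = j then x$k else 0)) +
    chris_rad m (norm x) *
      ((if j = k \<and> i = l then 1 else 0) + (if i = k \<and> j = l then 1 else 0) - (if i = j \<and> k = l then 1 else 0))"
    by simp
  finally show ?thesis .
qed

lemma num3_neq: "(1::3) \<noteq> 2" "(2::3) \<noteq> 1" "(1::3) \<noteq> 3" "(3::3) \<noteq> 1" "(2::3) \<noteq> 3" "(3::3) \<noteq> 2"
  by simp_all

lemma norm_vec3_sq: "(norm (x::real^3))^2 = (x$1)^2 + (x$2)^2 + (x$3)^2"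
  by (simp add: norm_vec_def L2_set_def sum_3)

lemma ricci_comp_33:
  assumes "m > 0" "x \<noteq> 0" "x$3 = 0"
  shows "ricci_comp (schw m) 3 3 x = m / (norm x * (norm x + m/2)^2)"
proof -
  define r where "r = norm x"
  have r: "r > 0" using assms by (simp add: r_def)
  have r2: "r^2 = (x$1)^2 + (x$2)^2" using norm_vec3_sq[of x] assms by (simp add: r_def)
  have "ricci_comp (schw m) 3 3 x =
     - chris_rad' m r * (((x$1)^2 + (x$2)^2) / r) - 4 * chris_rad m r
     - (chris_rad m r)^2 * ((x$1)^2 + (x$2)^2)"
    unfolding ricci_comp_def sum_3 pd_christoffel_schw[OF assms(1,2)] christoffel_schw[OF assms(1,2)]
      r_def[symmetric] using r
    by (simp add: assms(3) num3_neq) (simp add: field_simps power2_eq_square)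
  also have "\<dots> = - chris_rad' m r * r - 4 * chris_rad m r - (chris_rad m r)^2 * r^2"
    unfolding r2[symmetric] by (simp add: power2_eq_square)
  also have "\<dots> = m / (r * (r + m/2)^2)"
  proof -
    \<comment> \<open>In r and s all denominators are monomials, and eliminating m leaves a
      polynomial identity.\<close>
    define s where "s = r + m/2"
    have s: "s > 0" "m = 2 * (s - r)" using r assms by (auto simp: s_def)
    have "- (m * (3 * r + m) / (r ^ 3 * s\<^sup>2)) * r - 4 * (- m / (r\<^sup>2 * s)) - (- m / (r\<^sup>2 * s))\<^sup>2 * r\<^sup>2
        = m / (r * s\<^sup>2)"
      using r s(1) unfolding s(2)
      by (simp add: divide_simps power2_eq_square power3_eq_cube) (simp add: algebra_simps)
    then show ?thesis unfolding chris_rad_def chris_rad'_def s_def by simp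
  qed
  finally show ?thesis by (simp add: r_def)
qed

section \<open>Unit normals and second fundamental forms\<close>

lemma unit_normal_of_schw:
  assumes "m > 0" "y \<noteq> 0"
  shows "unit_normal_of (schw m) D y = (1 / (sqrt (confac m (norm y)) * norm (D y))) *\<^sub>R D y"
proof -
  define c where "c = confac m (norm y)"
  have c: "c > 0" using confac_pos[of m "norm y"] assms by (simp add: c_def)
  have v: "matrix_inv (schw m y) *v D y = (1/c) *\<^sub>R D y"
    unfolding matrix_inv_schw[OF assms] c_def[symmetric]
    by (simp add: vec_eq_iff matrix_vector_mult_def if_distrib[of "\<lambda>c. c * _"] if_distrib[of "\<lambda>c. _ * c"] cong: if_cong)
  have "ginner (schw m) y ((1/c) *\<^sub>R D y) ((1/c) *\<^sub>R D y) = (norm (D y))^2 / c"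
    unfolding ginner_def schw_nth c_def[symmetric] sum_3 norm_vec3_sq using c
    by (simp add: field_simps power2_eq_square)
  then have "sqrt (ginner (schw m) y ((1/c) *\<^sub>R D y) ((1/c) *\<^sub>R D y)) = norm (D y) / sqrt c"
    by (simp add: real_sqrt_divide)
  moreover have "sqrt c / c = 1 / sqrt c"
    using c by (simp add: field_simps)
  ultimately show ?thesis
    unfolding unit_normal_of_def Let_def v c_def[symmetric] by (simp add: field_simps)
qed

lemma plane_normal_schw:
  assumes "m > 0" "y \<noteq> 0"
  shows "plane_normal m y = (1 / sqrt (confac m (norm y))) *\<^sub>R axis 3 1"
  unfolding plane_normal_def unit_normal_of_schw[OF assms] by simp

lemma horizon_normal_schw:
  assumes "m > 0" "y \<noteq> 0"
  shows "horizon_normal m y = (- 1 / (sqrt (confac m (norm y)) * norm y)) *\<^sub>R y"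
  unfolding horizon_normal_def unit_normal_of_schw[OF assms] using assms by simp

lemma ricci_plane_normal:
  assumes "m > 0" "x \<noteq> 0" "x$3 = 0"
  shows "ricci (schw m) x (plane_normal m x) (plane_normal m x) =
    m / (norm x * (norm x + m/2)^2) / confac m (norm x)"
  unfolding ricci_def sum_3 plane_normal_schw[OF assms(1,2)] using ricci_comp_33[OF assms]
    confac_pos[of m "norm x"] assms
  by (simp add: axis_def)

lemma plane_emb_nth [simp]: "plane_emb p $ 1 = p$1" "plane_emb p $ 2 = p$2" "plane_emb p $ 3 = 0"
  by (simp_all add: plane_emb_def)

lemma norm_plane_emb [simp]: "norm (plane_emb p) = norm p"
  by (simp add: norm_vec_def L2_set_def sum_3 sum_2)

lemma plane_emb_eq_0_iff [simp]: "plane_emb p = 0 \<longleftrightarrow> p = 0"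
  by (metis norm_eq_zero norm_plane_emb)

lemma plane_tan_nth [simp]: "plane_tan a $ 1 = (if a = 1 then 1 else 0)"
  "plane_tan a $ 2 = (if a = 2 then 1 else 0)" "plane_tan a $ 3 = 0"
  by (simp_all add: plane_tan_def axis_def)

text \<open>The normal has constant direction, and for tangential i and k the symbol with upper
  index k and lower indices i, 3 is zero or a multiple of x_3. Hence the derivative of the normal
  along the plane has no tangential part.\<close>

lemma plane_A_eq_0:
  assumes "m > 0" "p \<noteq> 0"
  shows "plane_A m p (plane_tan a) (plane_tan b) = 0"
proof -
  define x where "x = plane_emb p"
  have x: "x \<noteq> 0" "x$3 = 0" using assms by (auto simp: x_def)
  have 0: "pd (\<lambda>y. plane_normal m y $ k) i x = 0" if "k \<noteq> 3" for k i
  proof -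
    have "pd (\<lambda>y. plane_normal m y $ k) i x = pd (\<lambda>y. 0) i x"
      by (rule pd_cong_open[of "- {0}"]) (use x assms that in \<open>auto simp: plane_normal_schw axis_def\<close>)
    also have "\<dots> = 0" by (rule pd_eqI) simp
    finally show ?thesis .
  qed
  have "covd (schw m) (plane_normal m) (plane_tan a) x $ 1 = 0"
    "covd (schw m) (plane_normal m) (plane_tan a) x $ 2 = 0"
    unfolding covd_def using x assms
    by (simp_all add: sum_3 0 christoffel_schw plane_normal_schw axis_def num3_neq)
  then show ?thesis
    unfolding plane_A_def sff_def ginner_def x_def[symmetric] by (simp add: sum_3 schw_nth)
qed

lemma plane_A_sq_eq_0: "m > 0 \<Longrightarrow> p \<noteq> 0 \<Longrightarrow> plane_A_sq m p = 0"
  unfolding plane_A_sq_def by (simp add: plane_A_eq_0)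

text \<open>Concentric spheres are umbilic with a factor proportional to
  \<open>1 + chris_rad m r * r\<^sup>2 = 1 - m / (r + m/2)\<close>, which vanishes exactly at the
  horizon radius.\<close>

lemma sff_horizon_eq_0:
  assumes "m > 0" "norm x = m/2" "x$3 = 0"
  shows "sff (schw m) (horizon_normal m) x (plane_normal m x) (plane_normal m x) = 0"
proof -
  have x: "x \<noteq> 0" using assms by auto
  define F where "F r = - 1 / (sqrt (confac m r) * r)" for r
  have "pd (\<lambda>y. horizon_normal m y $ 3) 3 x = pd (\<lambda>y. F (norm y) * y $ 3) 3 x"
    by (rule pd_cong_open[of "- {0}"]) (use x assms in \<open>auto simp: horizon_normal_schw F_def\<close>)
  also have "\<dots> = F (norm x)"
  proof -
    \<comment> \<open>Differentiability of \<open>F\<close> is all that has to be known: its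
      derivative enters multiplied by x_3 = 0.\<close>
    obtain D where "(F has_real_derivative D) (at (norm x))"
    proof -
      have "confac m (norm x) > 0" "norm x \<noteq> 0" using confac_pos[of m "norm x"] x assms by auto
      then show ?thesis
        using that DERIV_divide[OF DERIV_const[of "- 1"] DERIV_mult[OF DERIV_chain2[OF
          DERIV_real_sqrt confac_has_real_derivative[of m "norm x"]] DERIV_ident]] assms(1)
        unfolding F_def by fastforce
    qed
    from DERIV_mult[OF radial_has_real_derivative_axis[OF x this, of 3] component_has_real_derivative_axis[of x 3 3]]
    show ?thesis using assms(3) by (intro pd_eqI) simp
  qed
  finally have pd3: "pd (\<lambda>y. horizon_normal m y $ 3) 3 x = F (norm x)" .
  have N: "plane_normal m x $ 1 = 0" "plane_normal m x $ 2 = 0"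
    using x assms(1) by (auto simp: plane_normal_schw axis_def)
  have H: "horizon_normal m x = F (norm x) *\<^sub>R x"
    using x assms(1) by (simp add: horizon_normal_schw F_def)
  have r2: "(x$1)^2 + (x$2)^2 = (m/2)^2" using norm_vec3_sq[of x] assms by simp
  have "covd (schw m) (horizon_normal m) (plane_normal m x) x $ 3 =
      plane_normal m x $ 3 * F (norm x) * (1 + chris_rad m (norm x) * ((x$1)^2 + (x$2)^2))"
    unfolding covd_def using x assms(1,3)
    by (simp add: sum_3 N H pd3 christoffel_schw num3_neq) (simp add: algebra_simps power2_eq_square)
  also have "\<dots> = 0"
    unfolding r2 assms(2) chris_rad_def using assms(1) by (simp add: field_simps power2_eq_square)
  finally show ?thesis
    unfolding sff_def ginner_def by (simp add: sum_3 schw_nth N)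
qed

section \<open>The index form as a Euclidean integral over the annulus\<close>

lemma ind_metric_schw: "ind_metric m p = (\<chi> a b. confac m (norm p) * (if a = b then 1 else 0))"
proof -
  have "ind_metric m p $ a $ b = confac m (norm p) * (if a = b then 1 else 0)" for a b
    unfolding ind_metric_def ginner_def using exhaust_2[of a] exhaust_2[of b]
    by (auto simp: sum_3 schw_nth)
  then show ?thesis by (simp add: vec_eq_iff)
qed

text \<open>In dimension two the conformal factor c cancels: the gradient term and the Ricci
  curvature of the unit normal each carry 1/c, and the area element is c.\<close>

lemma indexQ_integrand:
  assumes "m > 0" "p \<noteq> 0"
  shows "(grad_sq m u p
         - (ricci (schw m) (plane_emb p) (plane_normal m (plane_emb p)) (plane_normal m (plane_emb p))
            + plane_A_sq m p) * (u p)\<^sup>2) * area_elt m p =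
     (pd u 1 p)\<^sup>2 + (pd u 2 p)\<^sup>2 - m / (norm p * (norm p + m/2)\<^sup>2) * (u p)\<^sup>2"
proof -
  define c where "c = confac m (norm p)"
  have c: "c > 0" using confac_pos[of m "norm p"] assms by (simp add: c_def)
  have "det (ind_metric m p) = c^2"
    unfolding ind_metric_schw det_2 c_def by (simp add: power2_eq_square)
  then have "area_elt m p = c" using c by (simp add: area_elt_def)
  moreover have "ind_inv m p = (\<chi> a b. (1/c) * (if a = b then 1 else 0))"
    unfolding ind_inv_def ind_metric_schw using matrix_inv_scalar[of c] c by (simp add: c_def)
  then have "grad_sq m u p = ((pd u 1 p)\<^sup>2 + (pd u 2 p)\<^sup>2) / c"
    unfolding grad_sq_def by (simp add: sum_2 power2_eq_square add_divide_distrib)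
  moreover have "ricci (schw m) (plane_emb p) (plane_normal m (plane_emb p)) (plane_normal m (plane_emb p))
     = m / (norm p * (norm p + m/2)\<^sup>2) / c"
    using ricci_plane_normal[of m "plane_emb p"] assms by (simp add: c_def)
  ultimately show ?thesis
    using c assms by (simp add: plane_A_sq_eq_0 left_diff_distrib)
qed

lemma norm_bcurve:
  assumes "m > 0"
  shows "norm (bcurve m \<theta>) = m/2"
proof -
  have "(m/2 * cos \<theta>)^2 + (m/2 * sin \<theta>)^2 = (m/2)^2 * ((cos \<theta>)^2 + (sin \<theta>)^2)"
    by (simp only: power_mult_distrib distrib_left)
  also have "\<dots> = (m/2)^2" by simp
  finally have "sqrt ((m/2 * cos \<theta>)^2 + (m/2 * sin \<theta>)^2) = m/2"
    using assms by (simp add: real_sqrt_unique)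
  then show ?thesis unfolding norm_vec_def L2_set_def sum_2 bcurve_def vector_2 real_norm_def power2_abs .
qed

lemma indexQ_eq:
  assumes "m > 0"
  shows "indexQ m R u = integral (plane_dom m R)
    (\<lambda>p. (pd u 1 p)\<^sup>2 + (pd u 2 p)\<^sup>2 - m / (norm p * (norm p + m/2)\<^sup>2) * (u p)\<^sup>2)"
proof -
  have "integral {0..2*pi} (\<lambda>\<theta>.
        sff (schw m) (horizon_normal m) (plane_emb (bcurve m \<theta>))
            (plane_normal m (plane_emb (bcurve m \<theta>))) (plane_normal m (plane_emb (bcurve m \<theta>)))
        * (u (bcurve m \<theta>))\<^sup>2 * bspeed m \<theta>) = 0"
    by (simp add: sff_horizon_eq_0 assms norm_bcurve)
  moreover have "p \<noteq> 0" if "p \<in> plane_dom m R" for p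
    using that assms by (auto simp: plane_dom_def)
  ultimately show ?thesis
    unfolding indexQ_def
    by (simp only: add_0_right) (intro integral_cong indexQ_integrand assms)
qed

subsection \<open>Polar coordinates\<close>

text \<open>A combination of \<open>axis\<close> vectors, so that derivative and continuity rules
  apply to it directly.\<close>

definition polar :: "real \<Rightarrow> real \<Rightarrow> real^2" where
  "polar r \<theta> = (r * cos \<theta>) *\<^sub>R axis 1 1 + (r * sin \<theta>) *\<^sub>R axis 2 1"

lemma polar_nth [simp]: "polar r \<theta> $ 1 = r * cos \<theta>" "polar r \<theta> $ 2 = r * sin \<theta>"
  by (simp_all add: polar_def axis_def)

lemma norm_polar [simp]: "norm (polar r \<theta>) = \<bar>r\<bar>"
proof -
  have "(r * cos \<theta>)\<^sup>2 + (r * sin \<theta>)\<^sup>2 = r\<^sup>2 * ((cos \<theta>)\<^sup>2 + (sin \<theta>)\<^sup>2)"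
    by (simp only: power_mult_distrib distrib_left)
  then show ?thesis
    unfolding norm_vec_def L2_set_def sum_2 polar_nth real_norm_def power2_abs by simp
qed

lemma polar_exists:
  obtains \<theta> where "0 \<le> \<theta>" "\<theta> < 2 * pi" "p = polar (norm p) \<theta>"
proof (cases "p = 0")
  case True
  then show ?thesis using that[of 0] by (simp add: polar_def)
next
  case False
  have "(norm p)\<^sup>2 = (p$1)\<^sup>2 + (p$2)\<^sup>2"
    by (simp add: norm_vec_def L2_set_def sum_2)
  then have "(p$1 / norm p)\<^sup>2 + (p$2 / norm p)\<^sup>2 = 1"
    using False unfolding power_divide add_divide_distrib[symmetric] by (metis divide_self norm_eq_zero power_not_zero)
  then obtain t where "0 \<le> t" "t < 2*pi" "p$1 / norm p = cos t" "p$2 / norm p = sin t"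
    by (rule sincos_total_2pi)
  moreover from this have "p$1 = norm p * cos t" "p$2 = norm p * sin t"
    using False by (metis nonzero_mult_div_cancel_left norm_eq_zero times_divide_eq_right)+
  then have "p = polar (norm p) t"
    unfolding vec_eq_iff forall_2 polar_nth by blast
  ultimately show ?thesis using that by blast
qed

lemma polar_inj:
  assumes "polar r s = polar r' t" "r > 0" "r' > 0" "0 \<le> s" "s < 2 * pi" "0 \<le> t" "t < 2 * pi"
  shows "r = r' \<and> s = t"
proof -
  have r: "r = r'" using arg_cong[OF assms(1), of norm] assms(2,3) by (simp del: abs_eq_iff)
  have "cos s = cos t" "sin s = sin t"
    using arg_cong[OF assms(1), of "\<lambda>v. v$1"] arg_cong[OF assms(1), of "\<lambda>v. v$2"] r assms by auto
  then obtain n :: int where n: "s = t + 2 * pi * n" using sin_cos_eq_iff[of s t] by auto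
  have "\<bar>2 * pi * n\<bar> < 2 * pi * 1" using assms n by auto
  then have "\<bar>real_of_int n\<bar> < 1" by (simp add: abs_mult)
  then have "n = 0" by linarith
  then show ?thesis using n r by simp
qed

text \<open>The change of variables is carried out on \<open>real^2\<close> and the iterated
  integration on pairs. The coordinate bijection between them maps boxes to boxes and preserves
  their content.\<close>

lemma integral_vec2_eq_prod:
  fixes f :: "real \<times> real \<Rightarrow> real"
  assumes "continuous_on (cbox (a, c) (b, d)) f"
  shows "integral (cbox (vector [a, c]) (vector [b, d] :: real^2)) (\<lambda>v. f (v$1, v$2)) =
    integral (cbox (a, c) (b, d)) f"
proof -
  let ?g = "\<lambda>v::real^2. (v$1, v$2)" and ?h = "\<lambda>(x, y). vector [x, y] :: real^2"
  have gh: "?h (?g v) = v" "?g (?h w) = w" for v w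
    by (auto simp: vec_eq_iff forall_2 split: prod.split)
  have gim: "?g ` cbox u v = cbox (u$1, u$2) (v$1, v$2)" for u v :: "real^2"
  proof (intro equalityI subsetI)
    fix w assume "w \<in> cbox (u$1, u$2) (v$1, v$2)"
    then have "?h w \<in> cbox u v" by (auto simp: mem_box_cart forall_2 cbox_Pair_eq)
    then show "w \<in> ?g ` cbox u v" using gh(2)[of w] by (metis (no_types, lifting) image_eqI)
  qed (auto simp: mem_box_cart forall_2 cbox_Pair_eq)
  have him: "?h ` cbox u v = cbox (?h u) (?h v)" for u v
  proof -
    have "?h ` cbox u v = ?h ` ?g ` cbox (?h u) (?h v)" unfolding gim gh(2) by simp
    also have "\<dots> = cbox (?h u) (?h v)" unfolding image_image gh(1) by simp
    finally show ?thesis .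
  qed
  have ex2: "(\<exists>i::2. P i) \<longleftrightarrow> P 1 \<or> P 2" for P
    by (metis exhaust_2)
  have cont: "measure lborel (?g ` cbox u v) = 1 * measure lborel (cbox u v)" for u v :: "real^2"
    unfolding gim content_Pair
    by (auto simp: content_cbox_if_cart ex2 content_real_if interval_eq_empty_cart UNIV_2)
  have "(f has_integral integral (cbox (a, c) (b, d)) f) (cbox (a, c) (b, d))"
    using assms by (intro integrable_integral integrable_continuous)
  then have "((\<lambda>v. f (?g v)) has_integral (1/1) *\<^sub>R integral (cbox (a, c) (b, d)) f) (?h ` cbox (a, c) (b, d))"
  proof (rule has_integral_twiddle[rotated -1, where h = ?h and g = ?g])
    show "\<exists>w z. ?g ` cbox u v = cbox w z" for u v using gim by blast
    show "\<exists>w z. ?h ` cbox u v = cbox w z" for u v using him by blast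
    show "measure lborel (?g ` cbox u v) = 1 * measure lborel (cbox u v)" for u v by (rule cont)
    show "isCont ?g v" for v by (intro continuous_intros)
  qed (use gh in auto)
  then show ?thesis
    unfolding him by (simp add: integral_unique)
qed

lemma integral_polar:
  fixes F :: "real^2 \<Rightarrow> real"
  assumes "0 < a" "a \<le> R" and F: "continuous_on {p. a \<le> norm p \<and> norm p \<le> R} F"
  shows "integral {p. a \<le> norm p \<and> norm p \<le> R} F =
    integral {a..R} (\<lambda>r. integral {0..2*pi} (\<lambda>\<theta>. r * F (polar r \<theta>)))"
proof -
  \<comment> \<open>The angle interval is half-open to make the polar map injective; the edge lost
    from the closed box \<open>C\<close> is negligible.\<close>
  define S :: "(real^2) set" where "S = {v. a \<le> v$1 \<and> v$1 \<le> R \<and> 0 \<le> v$2 \<and> v$2 < 2*pi}"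
  define C :: "(real^2) set" where "C = cbox (vector [a, 0]) (vector [R, 2*pi])"
  define g where "g v = polar (v$1) (v$2)" for v :: "real^2"
  define g' :: "real^2 \<Rightarrow> real^2 \<Rightarrow> real^2" where "g' v h =
    (cos (v$2) * h$1 - v$1 * sin (v$2) * h$2) *\<^sub>R axis 1 1 +
    (sin (v$2) * h$1 + v$1 * cos (v$2) * h$2) *\<^sub>R axis 2 1" for v h
  define H where "H = (\<lambda>(r, \<theta>). r * F (polar r \<theta>))"
  have SC: "S \<subseteq> C" "C - S \<subseteq> {v. v$2 = 2*pi}"
    by (auto simp: S_def C_def mem_box_cart forall_2)
  have neg: "negligible {v::real^2. v$2 = 2*pi}"
    using negligible_standard_hyperplane[of "axis 2 1 :: real^2" "2*pi"]
    by (simp add: axis_in_Basis_iff inner_axis)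
  have gS: "g ` S = {p. a \<le> norm p \<and> norm p \<le> R}"
  proof (intro equalityI subsetI)
    fix p :: "real^2" assume p: "p \<in> {p. a \<le> norm p \<and> norm p \<le> R}"
    obtain t where "0 \<le> t" "t < 2*pi" "p = polar (norm p) t" by (rule polar_exists)
    then have "vector [norm p, t] \<in> S" "g (vector [norm p, t]) = p"
      using p by (auto simp: S_def g_def)
    then show "p \<in> g ` S" by force
  qed (use assms in \<open>auto simp: g_def S_def\<close>)
  have inj: "inj_on g S"
  proof (rule inj_onI)
    fix v w assume "v \<in> S" "w \<in> S" "g v = g w"
    then have "v$1 = w$1 \<and> v$2 = w$2"
      using assms by (intro polar_inj) (auto simp: S_def g_def)
    then show "v = w" by (simp add: vec_eq_iff forall_2)
  qed
  have der: "(g has_derivative g' v) (at v within S)" for v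
    unfolding g_def polar_def g'_def
    by (auto intro!: derivative_eq_intros bounded_linear_imp_has_derivative[OF bounded_linear_vec_nth]
        simp: fun_eq_iff algebra_simps)
  have det: "det (matrix (g' v)) = v$1" for v
  proof -
    have "det (matrix (g' v)) = v$1 * (cos (v$2) * cos (v$2)) + v$1 * (sin (v$2) * sin (v$2))"
      by (simp add: det_2 matrix_def g'_def axis_def)
    also have "\<dots> = v$1 * ((cos (v$2))\<^sup>2 + (sin (v$2))\<^sup>2)"
      by (simp only: power2_eq_square distrib_left)
    finally show ?thesis by simp
  qed
  have contH: "continuous_on (cbox (a, 0) (R, 2*pi)) H"
    unfolding H_def case_prod_beta using assms
    by (intro continuous_intros continuous_on_compose2[OF F, where f="\<lambda>w. polar (fst w) (snd w)"])
      (auto simp: polar_def[abs_def] cbox_Pair_eq norm_polar[unfolded polar_def] intro!: continuous_intros)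
  have contC: "continuous_on C (\<lambda>v. H (v$1, v$2))"
    using assms
    by (intro continuous_on_compose2[OF contH] continuous_intros)
      (auto simp: C_def mem_box_cart forall_2 cbox_Pair_eq)
  have meas: "S \<in> sets lebesgue"
  proof -
    have "S = C - {v. v$2 = 2*pi}" by (auto simp: S_def C_def mem_box_cart forall_2)
    then show ?thesis using neg by (auto simp: C_def negligible_iff_null_sets intro!: sets.Diff)
  qed
  have eqH: "\<bar>det (matrix (g' v))\<bar> * F (g v) = H (v$1, v$2)" if "v \<in> S" for v
    using that assms by (simp add: det H_def g_def S_def)
  have "(\<lambda>v. H (v$1, v$2)) absolutely_integrable_on C"
    using contC unfolding C_def by (rule absolutely_integrable_continuous)
  then have "(\<lambda>v. H (v$1, v$2)) absolutely_integrable_on S"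
    using SC meas by (meson set_integrable_subset)
  then have ab: "(\<lambda>v. \<bar>det (matrix (g' v))\<bar> * F (g v)) absolutely_integrable_on S"
    using eqH by (simp cong: set_integrable_cong)
  \<comment> \<open>The change of variables theorem is applied to functions with values in
    \<open>real^1\<close>, whence the wrapping by \<open>vec\<close>.\<close>
  have "(\<lambda>v. \<bar>det (matrix (g' v))\<bar> *\<^sub>R (vec (F (g v)) :: real^1)) absolutely_integrable_on S
     \<and> integral S (\<lambda>v. \<bar>det (matrix (g' v))\<bar> *\<^sub>R (vec (F (g v)) :: real^1)) = vec b \<longleftrightarrow>
     (\<lambda>p. vec (F p) :: real^1) absolutely_integrable_on (g ` S) \<and> integral (g ` S) (\<lambda>p. vec (F p) :: real^1) = vec b" for b
    by (rule has_absolute_integral_change_of_variables[OF meas der inj])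
  from this[of "integral S (\<lambda>v. \<bar>det (matrix (g' v))\<bar> * F (g v))"]
  have "integral (g ` S) F = integral S (\<lambda>v. \<bar>det (matrix (g' v))\<bar> * F (g v))"
    using ab by (simp add: absolutely_integrable_on_1_iff integral_on_1_eq)
  also have "\<dots> = integral S (\<lambda>v. H (v$1, v$2))"
    using eqH by (rule integral_cong)
  also have "\<dots> = integral C (\<lambda>v. H (v$1, v$2))"
    by (rule integral_spike_set) (rule negligible_subset[OF neg], use SC in blast)+
  also have "\<dots> = integral (cbox (a, 0) (R, 2*pi)) H"
    unfolding C_def by (rule integral_vec2_eq_prod[OF contH])
  also have "\<dots> = integral {a..R} (\<lambda>r. integral {0..2*pi} (\<lambda>\<theta>. r * F (polar r \<theta>)))"
    using integral_prod_continuous[OF contH] by (simp add: H_def)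
  finally show ?thesis unfolding gS .
qed

subsection \<open>One-dimensional inequalities\<close>

text \<open>Expanding \<open>0 \<le> w * (f' - P * f / w)\<^sup>2\<close>: a subsolution \<open>P\<close> of the
  Riccati equation reduces a quadratic form to its boundary terms.\<close>
lemma riccati_lower_bound:
  fixes f f' P P' V w :: "real \<Rightarrow> real"
  assumes "x \<le> y"
    and w: "\<And>t. t \<in> {x..y} \<Longrightarrow> w t > 0"
    and P: "\<And>t. t \<in> {x..y} \<Longrightarrow> (P has_real_derivative P' t) (at t within {x..y})"
    and f: "\<And>t. t \<in> {x..y} \<Longrightarrow> (f has_real_derivative f' t) (at t within {x..y})"
    and ric: "\<And>t. t \<in> {x..y} \<Longrightarrow> P' t + (P t)\<^sup>2 / w t + V t \<le> 0"
    and int: "(\<lambda>t. w t * (f' t)\<^sup>2 - V t * (f t)\<^sup>2) integrable_on {x..y}"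
  shows "P y * (f y)\<^sup>2 - P x * (f x)\<^sup>2 \<le> integral {x..y} (\<lambda>t. w t * (f' t)\<^sup>2 - V t * (f t)\<^sup>2)"
proof (rule has_integral_le)
  show "((\<lambda>t. P' t * (f t)\<^sup>2 + 2 * P t * f t * f' t) has_integral P y * (f y)\<^sup>2 - P x * (f x)\<^sup>2) {x..y}"
  proof (rule fundamental_theorem_of_calculus[OF assms(1)])
    fix t assume t: "t \<in> {x..y}"
    have "((\<lambda>t. P t * (f t)\<^sup>2) has_real_derivative P' t * (f t)\<^sup>2 + 2 * P t * f t * f' t) (at t within {x..y})"
      by (rule derivative_eq_intros P[OF t] f[OF t] refl)+ (simp add: algebra_simps)
    then show "((\<lambda>t. P t * (f t)\<^sup>2) has_vector_derivative P' t * (f t)\<^sup>2 + 2 * P t * f t * f' t) (at t within {x..y})"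
      by (simp add: has_real_derivative_iff_has_vector_derivative)
  qed
  show "((\<lambda>t. w t * (f' t)\<^sup>2 - V t * (f t)\<^sup>2) has_integral
      integral {x..y} (\<lambda>t. w t * (f' t)\<^sup>2 - V t * (f t)\<^sup>2)) {x..y}"
    using int by (rule integrable_integral)
  fix t assume t: "t \<in> {x..y}"
  have "0 \<le> w t * (f' t - P t * f t / w t)\<^sup>2"
    using w[OF t] by simp
  also have "\<dots> = w t * (f' t)\<^sup>2 - 2 * P t * f t * f' t + ((P t)\<^sup>2 / w t) * (f t)\<^sup>2"
    using w[OF t] by (simp add: power2_eq_square field_simps)
  finally have "2 * P t * f t * f' t \<le> w t * (f' t)\<^sup>2 + ((P t)\<^sup>2 / w t) * (f t)\<^sup>2" by simp
  moreover have "(P' t + (P t)\<^sup>2 / w t + V t) * (f t)\<^sup>2 \<le> 0"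
    using ric[OF t] by (simp add: mult_nonpos_nonneg)
  ultimately show "P' t * (f t)\<^sup>2 + 2 * P t * f t * f' t \<le> w t * (f' t)\<^sup>2 - V t * (f t)\<^sup>2"
    by (simp add: algebra_simps)
qed

lemma integral_diff_const_square:
  fixes g :: "real \<Rightarrow> real"
  assumes "a \<le> b" "continuous_on {a..b} g"
  shows "integral {a..b} (\<lambda>t. (g t - c)\<^sup>2) =
    integral {a..b} (\<lambda>t. (g t)\<^sup>2) - 2 * c * integral {a..b} g + c\<^sup>2 * (b - a)"
proof -
  have i: "(\<lambda>t. (g t)\<^sup>2) integrable_on {a..b}" "g integrable_on {a..b}"
    using assms by (auto intro!: integrable_continuous_interval continuous_intros)
  have "((\<lambda>t. (g t)\<^sup>2 - 2 * c * g t + c\<^sup>2) has_integral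
     integral {a..b} (\<lambda>t. (g t)\<^sup>2) - 2 * c * integral {a..b} g + (b - a) *\<^sub>R c\<^sup>2) {a..b}"
    using has_integral_const_real[of "c\<^sup>2" a b] assms(1)
    by (intro has_integral_add has_integral_diff has_integral_mult_right integrable_integral i) simp
  then show ?thesis
    by (simp add: power2_diff integral_unique algebra_simps)
qed

text \<open>The mean minimises the square deviation: the two sides differ by
  \<open>(b - a) * (c - mean)\<^sup>2\<close>.\<close>

lemma variance_integral_le:
  fixes g :: "real \<Rightarrow> real"
  assumes "a < b" "continuous_on {a..b} g"
  shows "integral {a..b} (\<lambda>t. (g t)\<^sup>2) - (integral {a..b} g)\<^sup>2 / (b - a) \<le> integral {a..b} (\<lambda>t. (g t - c)\<^sup>2)"
proof -
  define I l where "I = integral {a..b} g" and "l = b - a"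
  have l: "l > 0" using assms by (simp add: l_def)
  have "0 \<le> l * (c - I / l)\<^sup>2" using l by simp
  also have "\<dots> = c\<^sup>2 * l - 2 * c * I + I\<^sup>2 / l"
    using l by (simp add: power2_eq_square field_simps)
  finally show ?thesis
    using integral_diff_const_square[of a b g c] assms by (simp add: I_def l_def)
qed

text \<open>Cauchy-Schwarz against constants, read off from the nonnegative square deviation from
  the mean.\<close>

lemma square_integral_le:
  fixes g :: "real \<Rightarrow> real"
  assumes "a < b" "continuous_on {a..b} g"
  shows "(integral {a..b} g)\<^sup>2 / (b - a) \<le> integral {a..b} (\<lambda>t. (g t)\<^sup>2)"
proof -
  define I l where "I = integral {a..b} g" and "l = b - a"
  have l: "l > 0" using assms by (simp add: l_def)
  have "0 \<le> integral {a..b} (\<lambda>t. (g t - I / l)\<^sup>2)"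
    using assms by (intro integral_nonneg integrable_continuous_interval continuous_intros) auto
  also have "\<dots> = integral {a..b} (\<lambda>t. (g t)\<^sup>2) - 2 * (I / l) * I + (I / l)\<^sup>2 * l"
    using integral_diff_const_square[of a b g "I / l"] assms by (simp add: I_def l_def)
  also have "\<dots> = integral {a..b} (\<lambda>t. (g t)\<^sup>2) - I\<^sup>2 / l"
    using l by (simp add: power2_eq_square)
  finally show ?thesis by (simp add: I_def l_def)
qed

text \<open>\<open>q\<close> is the logarithmic derivative of
  \<open>cos (sqrt (1/2) * (t - c))\<close>, a solution of h'' + h/2 = 0. The frequency is below 1,
  so there is no zero within distance pi/2 of c, endpoints included. Boundary terms are kept because
  an arc may end where \<open>f\<close> does not vanish.\<close>

lemma dirichlet_interval_bound:
  fixes f f' :: "real \<Rightarrow> real"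
  assumes "x \<le> y" "c - pi/2 \<le> x" "y \<le> c + pi/2"
    and f: "\<And>t. (f has_real_derivative f' t) (at t)" and f': "continuous_on UNIV f'"
  defines "q \<equiv> \<lambda>t. - sqrt (1/2) * tan (sqrt (1/2) * (t - c))"
  shows "q y * (f y)\<^sup>2 - q x * (f x)\<^sup>2 \<le> integral {x..y} (\<lambda>t. (f' t)\<^sup>2 - (f t)\<^sup>2 / 2)"
proof -
  define l where "l = sqrt (1/2)"
  have l: "0 < l" "l < 1" "l * l = 1/2" by (auto simp: l_def)
  have cs: "cos (l * (t - c)) \<noteq> 0" if "t \<in> {x..y}" for t
  proof -
    have "\<bar>t - c\<bar> \<le> pi/2" using that assms(2,3) unfolding abs_le_iff by auto
    then have "l * \<bar>t - c\<bar> \<le> l * (pi/2)" using l by (intro mult_left_mono) auto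
    also have "\<dots> < 1 * (pi/2)" using l pi_gt_zero by (intro mult_strict_right_mono) auto
    finally have "\<bar>l * (t - c)\<bar> < pi/2" using l by (simp add: abs_mult)
    then have "- (pi/2) < l * (t - c)" "l * (t - c) < pi/2" unfolding abs_less_iff by linarith+
    then show ?thesis using cos_gt_zero_pi[of "l * (t - c)"] by simp
  qed
  have "q y * (f y)\<^sup>2 - q x * (f x)\<^sup>2 \<le> integral {x..y} (\<lambda>t. 1 * (f' t)\<^sup>2 - 1/2 * (f t)\<^sup>2)"
  proof (rule riccati_lower_bound[OF assms(1)])
    fix t assume t: "t \<in> {x..y}"
    show "(q has_real_derivative - (1/2) * (1 + (tan (l * (t - c)))\<^sup>2)) (at t within {x..y})"
    proof -
      have "(q has_real_derivative - (l * l) * (1 + (tan (l * (t - c)))\<^sup>2)) (at t within {x..y})"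
        unfolding q_def l_def[symmetric] using cs[OF t]
        by (auto intro!: derivative_eq_intros simp: tan_sec inverse_eq_divide power_divide)
      then show ?thesis unfolding l(3) .
    qed
    have "(q t)\<^sup>2 = (l * l) * (tan (l * (t - c)))\<^sup>2"
      by (simp add: q_def l_def[symmetric] power2_eq_square)
    then show "- (1/2) * (1 + (tan (l * (t - c)))\<^sup>2) + (q t)\<^sup>2 / 1 + 1/2 \<le> 0"
      unfolding l(3) by (simp add: add_divide_distrib)
    show "(f has_real_derivative f' t) (at t within {x..y})"
      using f by (rule has_field_derivative_at_within)
  next
    have "continuous_on {x..y} f" using f by (meson DERIV_isCont continuous_at_imp_continuous_on)
    then show "(\<lambda>t. 1 * (f' t)\<^sup>2 - 1/2 * (f t)\<^sup>2) integrable_on {x..y}"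
      using continuous_on_subset[OF f'] by (intro integrable_continuous_interval continuous_intros) auto
  qed simp
  then show ?thesis by simp
qed

text \<open>The bracket on the left is the least squared distance of \<open>v\<close> from a
  constant, so it suffices to estimate \<open>v\<close> minus one well chosen value.\<close>

lemma poincare_circle:
  fixes v v' :: "real \<Rightarrow> real"
  assumes v: "\<And>t. (v has_real_derivative v' t) (at t)" and v': "continuous_on UNIV v'"
    and per: "\<And>t. v (t + 2 * pi) = v t"
  shows "(integral {0..2*pi} (\<lambda>t. (v t)\<^sup>2) - (integral {0..2*pi} v)\<^sup>2 / (2 * pi)) / 2
    \<le> integral {0..2*pi} (\<lambda>t. (v' t)\<^sup>2)"
proof -
  have cv: "continuous_on A v" for A
    using v by (meson DERIV_isCont continuous_at_imp_continuous_on)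
  \<comment> \<open>\<open>v\<close> takes equal values at some pair of antipodal points; subtracting that value leaves
    Dirichlet conditions on two half circles.\<close>
  define d where "d t = v t - v (t + pi)" for t
  have cd: "continuous_on A d" for A
    unfolding d_def by (intro continuous_intros cv continuous_on_compose2[OF cv[of UNIV]]) auto
  \<comment> \<open>Opposite values at 0 and pi let the intermediate value theorem act, upwards or
    downwards according to the sign of \<open>d 0\<close>.\<close>
  have "d pi = - d 0" using per[of 0] by (simp add: d_def)
  then have "\<exists>a\<ge>0. a \<le> pi \<and> d a = 0"
    using IVT'[of d 0 0 pi, OF _ _ _ cd] IVT2'[of d pi 0 0, OF _ _ _ cd] by force
  then obtain a where a: "0 \<le> a" "a \<le> pi" "d a = 0" by blast
  define z where "z t = v t - v a" for t
  have z: "(z has_real_derivative v' t) (at t)" for t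
    unfolding z_def by (auto intro!: derivative_eq_intros v)
  have z0: "z a = 0" "z (a + pi) = 0" "z (2 * pi) = z 0"
    using a(3) per[of 0] by (auto simp: z_def d_def)
  define e where "e t = (v' t)\<^sup>2 - (z t)\<^sup>2 / 2" for t
  have ie: "e integrable_on {x..y}" for x y
    unfolding e_def z_def using continuous_on_subset[OF v']
    by (intro integrable_continuous_interval continuous_intros cv) auto
  \<comment> \<open>The terms at \<open>0\<close> and \<open>2 * pi\<close> cancel because the two outer arcs form one half circle.\<close>
  have "integral {0..2*pi} e = integral {0..a} e + integral {a..a+pi} e + integral {a+pi..2*pi} e"
    using Henstock_Kurzweil_Integration.integral_combine[OF _ _ ie, of 0 a "a + pi"]
      Henstock_Kurzweil_Integration.integral_combine[OF _ _ ie, of 0 "a + pi" "2 * pi"] a by simp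
  moreover have "sqrt (1/2) * tan (sqrt (1/2) * (0 - (a - pi/2))) * (z 0)\<^sup>2 \<le> integral {0..a} e"
    using dirichlet_interval_bound[OF _ _ _ z v', of 0 a "a - pi/2"] a z0 unfolding e_def by simp
  moreover have "0 \<le> integral {a..a+pi} e"
    using dirichlet_interval_bound[OF _ _ _ z v', of a "a + pi" "a + pi/2"] a z0 unfolding e_def by simp
  moreover have "- sqrt (1/2) * tan (sqrt (1/2) * (2 * pi - (a + 3 * pi/2))) * (z 0)\<^sup>2 \<le> integral {a+pi..2*pi} e"
    using dirichlet_interval_bound[OF _ _ _ z v', of "a + pi" "2 * pi" "a + 3 * pi/2"] a z0 unfolding e_def by simp
  moreover have "2 * pi - (a + 3 * pi/2) = 0 - (a - pi/2)" by simp
  ultimately have "0 \<le> integral {0..2*pi} e" by simp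
  also have "integral {0..2*pi} e = integral {0..2*pi} (\<lambda>t. (v' t)\<^sup>2) - integral {0..2*pi} (\<lambda>t. (z t)\<^sup>2) / 2"
    unfolding e_def z_def using continuous_on_subset[OF v'] cv
    by (subst integral_diff) (auto intro!: integrable_continuous_interval continuous_intros)
  finally show ?thesis
    using variance_integral_le[of 0 "2 * pi" v "v a"] cv pi_gt_zero unfolding z_def by simp
qed

lemma radial_form_nonneg:
  fixes f f' :: "real \<Rightarrow> real"
  assumes "0 < a" "2 * a \<le> R"
    and f: "\<And>t. t \<in> {a..R} \<Longrightarrow> (f has_real_derivative f' t) (at t within {a..R})"
    and f': "continuous_on {a..R} f'"
    and "f (2 * a) = 0" "f R = 0"
  shows "0 \<le> integral {a..R} (\<lambda>r. r * (f' r)\<^sup>2 - 2 * a / (r + a)\<^sup>2 * (f r)\<^sup>2)"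
proof -
  define e where "e r = r * (f' r)\<^sup>2 - 2 * a / (r + a)\<^sup>2 * (f r)\<^sup>2" for r
  have cf: "continuous_on {a..R} f" using f by (rule DERIV_continuous_on)
  have ie: "e integrable_on {a..R}"
    unfolding e_def using f' cf assms(1) by (intro integrable_continuous_interval continuous_intros) auto
  then have ies: "e integrable_on {x..y}" if "{x..y} \<subseteq> {a..R}" for x y
    using that integrable_on_subinterval by blast
  \<comment> \<open>The affine choice \<open>1 - r / a\<close> vanishes at the free end, where
    \<open>f\<close> is arbitrary. Its slope \<open>- 1 / a\<close> pays for two terms of at most
    \<open>1 / (2 * a)\<close> each: the first bound is attained at the cut r = 2a, the second at r
    = a.\<close>
  have "(1 - 2 * a / a) * (f (2 * a))\<^sup>2 - (1 - a / a) * (f a)\<^sup>2 \<le> integral {a..2*a} e"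
    unfolding e_def
  proof (rule riccati_lower_bound)
    fix r assume r: "r \<in> {a..2*a}"
    show "((\<lambda>r. 1 - r / a) has_real_derivative - 1 / a) (at r within {a..2*a})"
      using assms(1) by (auto intro!: derivative_eq_intros)
    show "(f has_real_derivative f' r) (at r within {a..2*a})"
      by (rule DERIV_subset[OF f]) (use r assms(1,2) in auto)
    have "2 * (r - a)\<^sup>2 - a * r = (2 * r - a) * (r - 2 * a)" by (simp add: algebra_simps power2_eq_square)
    also have "\<dots> \<le> 0" using r assms(1) by (intro mult_nonneg_nonpos) auto
    finally have "(1 - r / a)\<^sup>2 / r \<le> 1 / (2 * a)"
      using r assms(1) by (simp add: divide_simps power2_eq_square) (simp add: algebra_simps)
    moreover have "(2 * a)\<^sup>2 \<le> (r + a)\<^sup>2" using r assms(1) by (intro power_mono) auto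
    then have "2 * a / (r + a)\<^sup>2 \<le> 1 / (2 * a)"
      using r assms(1) by (simp add: divide_simps power2_eq_square)
    moreover have "- 1 / a + 1 / (2 * a) + 1 / (2 * a) = 0" using assms(1) by (simp add: field_simps)
    ultimately show "- 1 / a + (1 - r / a)\<^sup>2 / r + 2 * a / (r + a)\<^sup>2 \<le> 0" by linarith
  qed (use assms ies[unfolded e_def] in auto)
  \<comment> \<open>Here the Riccati solution is \<open>r * h' r / h r\<close> for the radial Jacobi field \<open>h r = (r - a) / (r + a)\<close>.\<close>
  moreover have "2 * a * R / (R\<^sup>2 - a\<^sup>2) * (f R)\<^sup>2 - 2 * a * (2 * a) / ((2 * a)\<^sup>2 - a\<^sup>2) * (f (2 * a))\<^sup>2
      \<le> integral {2*a..R} e"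
    unfolding e_def
  proof (rule riccati_lower_bound)
    fix r assume r: "r \<in> {2*a..R}"
    have nz: "(r - a) > 0" "r + a > 0" "r > 0" and fac: "r\<^sup>2 - a\<^sup>2 = (r - a) * (r + a)"
      using r assms(1) by (auto simp: algebra_simps power2_eq_square)
    show "((\<lambda>r. 2 * a * r / (r\<^sup>2 - a\<^sup>2)) has_real_derivative - 2 * a * (r\<^sup>2 + a\<^sup>2) / (r\<^sup>2 - a\<^sup>2)\<^sup>2) (at r within {2*a..R})"
    proof -
      have "r\<^sup>2 - a\<^sup>2 \<noteq> 0" using nz fac by simp
      then show ?thesis
        by (auto intro!: derivative_eq_intros simp: power2_eq_square)
          (simp add: algebra_simps minus_divide_left)
    qed
    show "(f has_real_derivative f' r) (at r within {2*a..R})"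
      by (rule DERIV_subset[OF f]) (use r assms(1,2) in auto)
    have "- 2 * a * (r\<^sup>2 + a\<^sup>2) / (r\<^sup>2 - a\<^sup>2)\<^sup>2 + (2 * a * r / (r\<^sup>2 - a\<^sup>2))\<^sup>2 / r + 2 * a / (r + a)\<^sup>2 = 0"
      unfolding fac using nz
      by (simp add: divide_simps power2_eq_square) (simp add: algebra_simps)
    then show "- 2 * a * (r\<^sup>2 + a\<^sup>2) / (r\<^sup>2 - a\<^sup>2)\<^sup>2 + (2 * a * r / (r\<^sup>2 - a\<^sup>2))\<^sup>2 / r + 2 * a / (r + a)\<^sup>2 \<le> 0"
      by simp
  qed (use assms ies[unfolded e_def] in auto)
  ultimately show ?thesis
    using Henstock_Kurzweil_Integration.integral_combine[OF _ _ ie, of "2 * a"] assms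
    unfolding e_def by simp
qed

subsection \<open>Nonnegativity under one linear constraint\<close>

lemma has_derivative_pd:
  fixes w :: "real^2 \<Rightarrow> real"
  assumes "w differentiable (at p)"
  shows "(w has_derivative (\<lambda>h. pd w 1 p * h$1 + pd w 2 p * h$2)) (at p)"
proof -
  from assms obtain D where D: "(w has_derivative D) (at p)" by (auto simp: differentiable_def)
  interpret D: bounded_linear D using D by (rule has_derivative_bounded_linear)
  have pd: "pd w k p = D (axis k 1)" for k
  proof (rule pd_eqI)
    have "((\<lambda>t. p + t *\<^sub>R axis k (1::real)) has_derivative (\<lambda>t. t *\<^sub>R axis k 1)) (at 0)"
      by (auto intro!: derivative_eq_intros)
    moreover have "(w has_derivative D) (at (p + 0 *\<^sub>R axis k (1::real)))" using D by simp
    ultimately have "(w \<circ> (\<lambda>t. p + t *\<^sub>R axis k (1::real)) has_derivative D \<circ> (\<lambda>t. t *\<^sub>R axis k 1)) (at 0)"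
      by (rule diff_chain_at)
    then show "((\<lambda>t. w (p + t *\<^sub>R axis k 1)) has_real_derivative D (axis k 1)) (at 0)"
      unfolding o_def has_field_derivative_def by (rule has_derivative_eq_rhs) (simp add: fun_eq_iff D.scaleR)
  qed
  have "D h = pd w 1 p * h$1 + pd w 2 p * h$2" for h
  proof -
    have "h = h$1 *\<^sub>R axis 1 1 + h$2 *\<^sub>R axis 2 1"
      by (simp add: vec_eq_iff forall_2 axis_def)
    then have "D h = D (h$1 *\<^sub>R axis 1 1 + h$2 *\<^sub>R axis 2 1)" by simp
    then show ?thesis by (simp add: D.add D.scaleR pd mult.commute)
  qed
  then have "D = (\<lambda>h. pd w 1 p * h$1 + pd w 2 p * h$2)" by blast
  then show ?thesis using D by simp
qed

lemma has_real_derivative_polar_radius: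
  assumes "w differentiable (at (polar r \<theta>))"
  shows "((\<lambda>r. w (polar r \<theta>)) has_real_derivative
    pd w 1 (polar r \<theta>) * cos \<theta> + pd w 2 (polar r \<theta>) * sin \<theta>) (at r)"
proof -
  have "((\<lambda>r. polar r \<theta>) has_derivative (\<lambda>h. polar h \<theta>)) (at r)"
    unfolding polar_def by (auto intro!: derivative_eq_intros)
  from diff_chain_at[OF this has_derivative_pd[OF assms]]
  show ?thesis
    unfolding has_field_derivative_def o_def
    by (rule has_derivative_eq_rhs) (simp add: fun_eq_iff algebra_simps)
qed

lemma has_real_derivative_polar_angle:
  assumes "w differentiable (at (polar r \<theta>))"
  shows "((\<lambda>\<theta>. w (polar r \<theta>)) has_real_derivative
    r * (pd w 2 (polar r \<theta>) * cos \<theta> - pd w 1 (polar r \<theta>) * sin \<theta>)) (at \<theta>)"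
proof -
  have "((\<lambda>\<theta>. polar r \<theta>) has_derivative
      (\<lambda>h. (- r * sin \<theta> * h) *\<^sub>R axis 1 1 + (r * cos \<theta> * h) *\<^sub>R axis 2 1)) (at \<theta>)"
    unfolding polar_def by (auto intro!: derivative_eq_intros simp: fun_eq_iff algebra_simps)
  from diff_chain_at[OF this has_derivative_pd[OF assms]]
  show ?thesis
    unfolding has_field_derivative_def o_def
    by (rule has_derivative_eq_rhs) (simp add: fun_eq_iff axis_def algebra_simps)
qed

lemma continuous_on_polar [continuous_intros]:
  fixes A :: "'a::t2_space set"
  shows "continuous_on A f \<Longrightarrow> continuous_on A g \<Longrightarrow> continuous_on A (\<lambda>x. polar (f x) (g x))"
  unfolding polar_def by (intro continuous_intros)

text \<open>The Jacobian r cancels one factor in the denominator of the potential.\<close>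

lemma indexQ_polar:
  assumes "m > 0" "m/2 \<le> R" "plane_dom m R \<subseteq> S"
    and "continuous_on S w" and pd: "\<And>k. continuous_on S (pd w k)"
  shows "indexQ m R w = integral {m/2..R} (\<lambda>r. integral {0..2*pi} (\<lambda>\<theta>.
     r * ((pd w 1 (polar r \<theta>))\<^sup>2 + (pd w 2 (polar r \<theta>))\<^sup>2) - m / (r + m/2)\<^sup>2 * (w (polar r \<theta>))\<^sup>2))"
proof -
  let ?F = "\<lambda>p. (pd w 1 p)\<^sup>2 + (pd w 2 p)\<^sup>2 - m / (norm p * (norm p + m/2)\<^sup>2) * (w p)\<^sup>2"
  have nz: "norm p * (norm p + m/2)\<^sup>2 \<noteq> 0" if "p \<in> plane_dom m R" for p
  proof -
    have "norm p > 0" "norm p + m/2 > 0" using that assms(1) unfolding plane_dom_def by auto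
    then show ?thesis by simp
  qed
  have "continuous_on (plane_dom m R) ?F"
    using assms(3) nz by (intro continuous_intros continuous_on_subset[OF pd] continuous_on_subset[OF assms(4)]) auto
  then have "integral (plane_dom m R) ?F =
      integral {m/2..R} (\<lambda>r. integral {0..2*pi} (\<lambda>\<theta>. r * ?F (polar r \<theta>)))"
    unfolding plane_dom_def using assms(1,2) by (intro integral_polar) auto
  also have "\<dots> = integral {m/2..R} (\<lambda>r. integral {0..2*pi} (\<lambda>\<theta>.
     r * ((pd w 1 (polar r \<theta>))\<^sup>2 + (pd w 2 (polar r \<theta>))\<^sup>2) - m / (r + m/2)\<^sup>2 * (w (polar r \<theta>))\<^sup>2))"
  proof (intro integral_cong)
    fix r \<theta> assume "r \<in> {m/2..R}"
    then have "r > 0" using assms(1) by auto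
    then show "r * ?F (polar r \<theta>) = r * ((pd w 1 (polar r \<theta>))\<^sup>2 + (pd w 2 (polar r \<theta>))\<^sup>2) - m / (r + m/2)\<^sup>2 * (w (polar r \<theta>))\<^sup>2"
      by (simp add: right_diff_distrib)
  qed
  finally show ?thesis using assms(1) by (simp add: indexQ_eq)
qed

lemma indexQ_nonneg:
  assumes m: "m > 0" "m \<le> R" and S: "plane_dom m R \<subseteq> S"
    and w: "\<And>p. p \<in> S \<Longrightarrow> w differentiable (at p)" and pd: "\<And>k. continuous_on S (pd w k)"
    and zero: "\<And>p. norm p = R \<Longrightarrow> w p = 0"
    and mean: "integral {0..2*pi} (\<lambda>\<theta>. w (polar m \<theta>)) = 0"
  shows "0 \<le> indexQ m R w"
proof -
  define a where "a = m/2"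
  have a: "a > 0" "2 * a \<le> R" "m = 2 * a" using m by (auto simp: a_def)
  have cw: "continuous_on S w"
    using w by (meson continuous_at_imp_continuous_on differentiable_imp_continuous_within)
  define U where "U r \<theta> = w (polar r \<theta>)" for r \<theta>
  define A where "A r \<theta> = pd w 1 (polar r \<theta>)" for r \<theta>
  define B where "B r \<theta> = pd w 2 (polar r \<theta>)" for r \<theta>
  define Ur where "Ur r \<theta> = A r \<theta> * cos \<theta> + B r \<theta> * sin \<theta>" for r \<theta>
  define Ut where "Ut r \<theta> = r * (B r \<theta> * cos \<theta> - A r \<theta> * sin \<theta>)" for r \<theta>
  have inS: "polar r \<theta> \<in> S" if "r \<in> {a..R}" for r \<theta>
    using that S a by (auto simp: plane_dom_def)
  have cont2: "continuous_on ({a..R} \<times> T) (\<lambda>x. h (polar (fst x) (snd x)))" if "continuous_on S h" for h :: "real^2 \<Rightarrow> real" and T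
    by (rule continuous_on_compose2[OF that]) (use inS in \<open>auto intro!: continuous_intros\<close>)
  have cont1: "continuous_on T (\<lambda>\<theta>. h (polar r \<theta>))" if "continuous_on S h" "r \<in> {a..R}" for h :: "real^2 \<Rightarrow> real" and r T
    by (rule continuous_on_compose2[OF that(1)]) (use inS that in \<open>auto intro!: continuous_intros\<close>)
  have c1: "continuous_on T (U r)" "continuous_on T (A r)" "continuous_on T (B r)" if "r \<in> {a..R}" for r T
    unfolding U_def A_def B_def by (intro cont1 cw pd that)+
  have cUr: "continuous_on T (Ur r)" and cUt: "continuous_on T (Ut r)" if "r \<in> {a..R}" for r T
    unfolding Ur_def Ut_def by (intro continuous_intros c1 that)+
  have c2: "continuous_on ({a..R} \<times> T) (\<lambda>x. U (fst x) (snd x))"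
      "continuous_on ({a..R} \<times> T) (\<lambda>x. A (fst x) (snd x))" "continuous_on ({a..R} \<times> T) (\<lambda>x. B (fst x) (snd x))" for T
    unfolding U_def A_def B_def by (intro cont2 cw pd)+
  have cUr2: "continuous_on ({a..R} \<times> T) (\<lambda>x. Ur (fst x) (snd x))" for T
    unfolding Ur_def by (intro continuous_intros c2)
  define f where "f = (\<lambda>r. integral {0..2*pi} (U r))"
  define f' where "f' = (\<lambda>r. integral {0..2*pi} (Ur r))"
  define E where "E r \<theta> = r * ((A r \<theta>)\<^sup>2 + (B r \<theta>)\<^sup>2) - 2 * a / (r + a)\<^sup>2 * (U r \<theta>)\<^sup>2" for r \<theta>
  have f: "(f has_real_derivative f' r) (at r within {a..R})" if "r \<in> {a..R}" for r
  proof -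
    have "((\<lambda>r. integral (cbox 0 (2*pi)) (U r)) has_real_derivative integral (cbox 0 (2*pi)) (Ur r))
        (at r within {a..R})"
    proof (rule leibniz_rule_field_derivative[where f = U and fx = Ur])
      fix s t assume "s \<in> {a..R}"
      then show "((\<lambda>x. U x t) has_real_derivative Ur s t) (at s within {a..R})"
        unfolding U_def Ur_def A_def B_def using inS[of s t] w
        by (intro has_field_derivative_at_within[OF has_real_derivative_polar_radius]) auto
    next
      show "U s integrable_on cbox 0 (2*pi)" if "s \<in> {a..R}" for s
        by (rule integrable_continuous[OF c1(1)[OF that]])
      show "continuous_on ({a..R} \<times> cbox 0 (2 * pi)) (\<lambda>(x, t). Ur x t)"
        using cUr2 by (simp add: case_prod_beta)
    qed (use that in auto)
    then show ?thesis by (simp add: f_def f'_def)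
  qed
  have param: "continuous_on {a..R} (\<lambda>r. integral {0..2*pi} (h r))"
    if "continuous_on ({a..R} \<times> {0..2*pi}) (\<lambda>x. h (fst x) (snd x))" for h :: "real \<Rightarrow> real \<Rightarrow> real"
    using integral_continuous_on_param[of "{a..R}" 0 "2*pi" h] that by (simp add: case_prod_beta)
  have cf': "continuous_on {a..R} f'"
    unfolding f'_def using cUr2 by (rule param)
  have cf: "continuous_on {a..R} f" using f by (rule DERIV_continuous_on)
  have f0: "f (2 * a) = 0" "f R = 0"
    using mean zero m by (auto simp: f_def U_def[abs_def] a(3)[symmetric])
  have cE: "continuous_on ({a..R} \<times> {0..2*pi}) (\<lambda>x. E (fst x) (snd x))"
    unfolding E_def using a by (intro continuous_intros c2) auto
  \<comment> \<open>On one circle, Cauchy-Schwarz bounds the radial energy below by that of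
    \<open>f\<close>, and the angular energy pays for the potential of the fluctuation. The factor
    \<open>1 / (2 * pi)\<close> arises because \<open>f\<close> is the integral over the circle, not
    the mean.\<close>
  have inner: "(r * (f' r)\<^sup>2 - 2 * a / (r + a)\<^sup>2 * (f r)\<^sup>2) / (2 * pi) \<le> integral {0..2*pi} (E r)"
    if r: "r \<in> {a..R}" for r
  proof -
    define \<kappa> where "\<kappa> = 2 * a / (r + a)\<^sup>2"
    define I where "I h = integral {0..2*pi} (\<lambda>\<theta>. (h r \<theta>)\<^sup>2)" for h :: "real \<Rightarrow> real \<Rightarrow> real"
    have r0: "r > 0" using r a by auto
    have int: "(\<lambda>\<theta>. (h r \<theta>)\<^sup>2) integrable_on {0..2*pi}" if "continuous_on {0..2*pi} (h r)" for h :: "real \<Rightarrow> real \<Rightarrow> real"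
      using that by (intro integrable_continuous_interval continuous_intros)
    have "E r = (\<lambda>\<theta>. r * (Ur r \<theta>)\<^sup>2 + (1 / r) * (Ut r \<theta>)\<^sup>2 - \<kappa> * (U r \<theta>)\<^sup>2)"
    proof
      fix \<theta>
      \<comment> \<open>Rotating the gradient by the angle gives its radial and angular
        components.\<close>
      have "(A r \<theta>)\<^sup>2 + (B r \<theta>)\<^sup>2 = ((A r \<theta>)\<^sup>2 + (B r \<theta>)\<^sup>2) * ((cos \<theta>)\<^sup>2 + (sin \<theta>)\<^sup>2)" by simp
      also have "\<dots> = (Ur r \<theta>)\<^sup>2 + (B r \<theta> * cos \<theta> - A r \<theta> * sin \<theta>)\<^sup>2"
        unfolding Ur_def by algebra
      finally have "E r \<theta> = r * ((Ur r \<theta>)\<^sup>2 + (B r \<theta> * cos \<theta> - A r \<theta> * sin \<theta>)\<^sup>2) - \<kappa> * (U r \<theta>)\<^sup>2"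
        by (simp add: E_def \<kappa>_def)
      then show "E r \<theta> = r * (Ur r \<theta>)\<^sup>2 + (1 / r) * (Ut r \<theta>)\<^sup>2 - \<kappa> * (U r \<theta>)\<^sup>2"
        unfolding Ut_def power_mult_distrib distrib_left using r0 by (simp add: power2_eq_square)
    qed
    then have "(E r has_integral r * I Ur + (1 / r) * I Ut - \<kappa> * I U) {0..2*pi}"
      unfolding I_def by (simp only:)
        (intro has_integral_add has_integral_diff has_integral_mult_right integrable_integral int c1 cUr cUt r)
    then have "integral {0..2*pi} (E r) = r * I Ur + (1 / r) * I Ut - \<kappa> * I U"
      by (rule integral_unique)
    moreover have "r * ((f' r)\<^sup>2 / (2 * pi)) \<le> r * I Ur"
      unfolding I_def f'_def using square_integral_le[of 0 "2*pi" "Ur r"] cUr[OF r] r0 by (intro mult_left_mono) auto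
    moreover have "(1 / r) * ((I U - (f r)\<^sup>2 / (2 * pi)) / 2) \<le> (1 / r) * I Ut"
    proof (rule mult_left_mono)
      show "(I U - (f r)\<^sup>2 / (2 * pi)) / 2 \<le> I Ut"
        unfolding I_def f_def
      proof (rule poincare_circle)
        show "(U r has_real_derivative Ut r t) (at t)" for t
          unfolding U_def Ut_def A_def B_def using inS[OF r] w by (intro has_real_derivative_polar_angle) auto
        show "U r (t + 2 * pi) = U r t" for t by (simp add: U_def polar_def)
      qed (rule cUt[OF r])
    qed (use r0 in simp)
    moreover have "\<kappa> * (I U - (f r)\<^sup>2 / (2 * pi)) \<le> 1 / (2 * r) * (I U - (f r)\<^sup>2 / (2 * pi))"
    proof (rule mult_right_mono)
      \<comment> \<open>Equality holds at the horizon r = a, so the Poincare constant 1/2 is just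
        enough there.\<close>
      have "0 \<le> (r - a)\<^sup>2" by simp
      then have "4 * a * r \<le> (r + a)\<^sup>2" by (simp add: power2_eq_square algebra_simps)
      then show "\<kappa> \<le> 1 / (2 * r)" unfolding \<kappa>_def using r0 a by (simp add: divide_simps)
      show "0 \<le> I U - (f r)\<^sup>2 / (2 * pi)"
        unfolding I_def f_def using square_integral_le[of 0 "2*pi" "U r"] c1(1)[OF r] by simp
    qed
    ultimately show ?thesis
      unfolding \<kappa>_def[symmetric] by (simp add: algebra_simps diff_divide_distrib)
  qed
  have "0 \<le> integral {a..R} (\<lambda>r. r * (f' r)\<^sup>2 - 2 * a / (r + a)\<^sup>2 * (f r)\<^sup>2) / (2 * pi)"
    using radial_form_nonneg[OF a(1,2) f cf' f0] by simp
  also have "\<dots> = integral {a..R} (\<lambda>r. (r * (f' r)\<^sup>2 - 2 * a / (r + a)\<^sup>2 * (f r)\<^sup>2) / (2 * pi))"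
    by simp
  also have "\<dots> \<le> integral {a..R} (\<lambda>r. integral {0..2*pi} (E r))"
  proof (rule integral_le)
    show "(\<lambda>r. (r * (f' r)\<^sup>2 - 2 * a / (r + a)\<^sup>2 * (f r)\<^sup>2) / (2 * pi)) integrable_on {a..R}"
      using a by (intro integrable_continuous_interval continuous_intros cf cf') auto
    have "continuous_on {a..R} (\<lambda>r. integral {0..2*pi} (E r))"
      using cE by (rule param)
    then show "(\<lambda>r. integral {0..2*pi} (E r)) integrable_on {a..R}"
      by (rule integrable_continuous_interval)
  qed (rule inner)
  also have "\<dots> = indexQ m R w"
    using indexQ_polar[OF m(1) _ S cw pd] m unfolding E_def A_def B_def U_def a(3) by simp
  finally show ?thesis .
qed

subsection \<open>A negative direction\<close>

text \<open>\<open>pd\<close> is a \<open>deriv\<close>, whose sum and product rules require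
  differentiability; the existence of the derivative therefore goes through the induction together
  with closure.\<close>

lemma real_polynomial_function_pd:
  fixes f :: "real^'n \<Rightarrow> real"
  assumes "real_polynomial_function f"
  shows "real_polynomial_function (pd f k) \<and>
    (\<forall>x. ((\<lambda>t. f (x + t *\<^sub>R axis k 1)) has_real_derivative pd f k x) (at 0))"
  using assms
proof induction
  case (linear f)
  interpret bounded_linear f by fact
  have der: "((\<lambda>t. f (x + t *\<^sub>R axis k 1)) has_real_derivative f (axis k 1)) (at 0)" for x
    unfolding add scaleR by (auto intro!: derivative_eq_intros)
  then have "pd f k = (\<lambda>x. f (axis k 1))" by (auto intro: pd_eqI)
  then show ?case using der by auto
next
  case (const c)
  have "pd (\<lambda>_. c) k = (\<lambda>x. 0)" by (intro ext pd_eqI) simp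
  then show ?case by auto
next
  case (add f g)
  have der: "((\<lambda>t. f (x + t *\<^sub>R axis k 1) + g (x + t *\<^sub>R axis k 1)) has_real_derivative pd f k x + pd g k x) (at 0)" for x
    using add.IH by (intro DERIV_add) auto
  then have "pd (\<lambda>x. f x + g x) k = (\<lambda>x. pd f k x + pd g k x)" by (auto intro: pd_eqI)
  then show ?case using der add.IH by auto
next
  case (mult f g)
  have der: "((\<lambda>t. f (x + t *\<^sub>R axis k 1) * g (x + t *\<^sub>R axis k 1)) has_real_derivative
      pd f k x * g x + pd g k x * f x) (at 0)" for x
    using DERIV_mult[of "\<lambda>t. f (x + t *\<^sub>R axis k 1)" "pd f k x" 0 UNIV "\<lambda>t. g (x + t *\<^sub>R axis k 1)" "pd g k x"]
      mult.IH by simp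
  then have "pd (\<lambda>x. f x * g x) k = (\<lambda>x. pd f k x * g x + pd g k x * f x)" by (auto intro: pd_eqI)
  then show ?case using der mult.IH mult.hyps by auto
qed

lemma smooth_on_real_polynomial_function:
  fixes f :: "real^'n \<Rightarrow> real"
  assumes "real_polynomial_function f"
  shows "smooth_on UNIV f"
proof -
  have "real_polynomial_function (pdl ks f)" for ks
    by (induction ks) (use assms real_polynomial_function_pd in auto)
  then show ?thesis
    unfolding smooth_on_def
    by (auto simp: real_polynomial_function_eq intro: differentiable_at_polynomial_function)
qed

text \<open>In \<open>\<rho> = r\<^sup>2 / R\<^sup>2\<close> the gradient energy of \<open>(1 - \<rho>)\<^sup>2\<close> tends to \<open>2/3\<close>, below the limit \<open>1\<close>
  of its potential energy; the simpler \<open>1 - \<rho>\<close> would give equality.\<close>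
definition bump :: "real \<Rightarrow> real^2 \<Rightarrow> real" where
  "bump R p = (R\<^sup>2 - ((p$1)\<^sup>2 + (p$2)\<^sup>2))\<^sup>2"

lemma real_polynomial_function_bump: "real_polynomial_function (\<lambda>p. c * bump R p)"
  unfolding bump_def power2_eq_square
  by (intro real_polynomial_function.intros real_polynomial_function_diff bounded_linear_vec_nth)

lemma norm_vec2_sq: "(norm (p::real^2))\<^sup>2 = (p$1)\<^sup>2 + (p$2)\<^sup>2"
  by (simp add: norm_vec_def L2_set_def sum_2)

lemma admissible_bump: "admissible m R (\<lambda>p. c * bump R p)"
  unfolding admissible_def
proof (intro conjI exI allI impI)
  show "smooth_on UNIV (\<lambda>p. c * bump R p)"
    by (rule smooth_on_real_polynomial_function[OF real_polynomial_function_bump])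
  show "c * bump R p = 0" if "norm p = R" for p
    using norm_vec2_sq[of p] that by (simp add: bump_def)
qed simp

lemma pd_bump: "pd (\<lambda>p. c * bump R p) k p = - 4 * c * (R\<^sup>2 - (norm p)\<^sup>2) * p$k"
proof (rule pd_eqI)
  have k: "k = 1 \<or> k = 2" by (rule exhaust_2)
  have "((\<lambda>t. c * bump R (p + t *\<^sub>R axis k 1)) has_real_derivative
      c * (2 * (R\<^sup>2 - ((p$1)\<^sup>2 + (p$2)\<^sup>2)) * - (2 * p$1 * (if 1 = k then 1 else 0) + 2 * p$2 * (if 2 = k then 1 else 0)))) (at 0)"
    unfolding bump_def
    by (rule component_has_real_derivative_axis derivative_eq_intros refl)+ simp
  then show "((\<lambda>t. c * bump R (p + t *\<^sub>R axis k 1)) has_real_derivative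
     - 4 * c * (R\<^sup>2 - (norm p)\<^sup>2) * p$k) (at 0)"
    unfolding norm_vec2_sq by (rule DERIV_cong) (use k in auto)
qed

lemma radial_form_bump_neg:
  fixes a R :: real
  assumes "a > 0" "R \<ge> 100 * a"
  shows "integral {a..R} (\<lambda>r. 16 * r^3 * (R\<^sup>2 - r\<^sup>2)\<^sup>2 - 2 * a / (r + a)\<^sup>2 * (R\<^sup>2 - r\<^sup>2)^4) < 0"
    (is "integral _ ?g < 0")
proof -
  \<comment> \<open>\<open>G'\<close> uses the Bernoulli bound
    \<open>(R\<^sup>2 - r\<^sup>2)^4 \<ge> R^8 - 4 * R^6 * r\<^sup>2\<close> and then
    \<open>r\<^sup>2 / (r + a)\<^sup>2 \<le> 1\<close>; it has the rational antiderivative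
    \<open>G\<close>.\<close>
  define G where "G r = 4 * R^4 * r^4 - 16/3 * R\<^sup>2 * r^6 + 2 * r^8 + 2 * a * R^8 / (r + a) + 8 * a * R^6 * r" for r
  define G' where "G' r = 16 * r^3 * (R\<^sup>2 - r\<^sup>2)\<^sup>2 - 2 * a * R^8 / (r + a)\<^sup>2 + 8 * a * R^6" for r
  have R: "R > 0" "a < R" using assms by auto
  have Gint: "(G' has_integral G R - G a) {a..R}"
  proof (rule fundamental_theorem_of_calculus)
    fix r assume "r \<in> {a..R}"
    then have "r + a \<noteq> 0" using assms by auto
    then have "(G has_real_derivative G' r) (at r within {a..R})"
      unfolding G_def G'_def
      by (auto intro!: derivative_eq_intros simp: power2_eq_square) (simp add: algebra_simps eval_nat_numeral)
    then show "(G has_vector_derivative G' r) (at r within {a..R})"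
      by (simp add: has_real_derivative_iff_has_vector_derivative)
  qed (use R in simp)
  have gint: "?g integrable_on {a..R}"
    using assms by (intro integrable_continuous_interval continuous_intros) auto
  have "integral {a..R} ?g \<le> G R - G a"
  proof (rule has_integral_le[OF integrable_integral[OF gint] Gint])
    fix r assume r: "r \<in> {a..R}"
    define s t where "s = R\<^sup>2" and "t = r\<^sup>2"
    have st: "0 \<le> t" "t \<le> s" using r assms by (auto simp: s_def t_def power_mono)
    \<comment> \<open>The second factor is \<open>6 * s\<^sup>2 - 4 * s * t + t\<^sup>2\<close>,
      written so that its sign is visible for t between 0 and s.\<close>
    have "0 \<le> t\<^sup>2 * ((s - t) * (5 * s + t) + s\<^sup>2 + 2 * t\<^sup>2)" using st by (intro mult_nonneg_nonneg add_nonneg_nonneg) auto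
    also have "\<dots> = t\<^sup>2 * (6 * s\<^sup>2 - 4 * s * t + t\<^sup>2)" by (simp add: power2_eq_square algebra_simps)
    also have "\<dots> = (s - t)^4 - (s^4 - 4 * s^3 * t)" by (simp add: eval_nat_numeral algebra_simps)
    finally have "s^4 - 4 * s^3 * t \<le> (s - t)^4" by simp
    then have "2 * a / (r + a)\<^sup>2 * (s^4 - 4 * s^3 * t) \<le> 2 * a / (r + a)\<^sup>2 * (s - t)^4"
      using assms by (intro mult_left_mono) auto
    moreover have "t / (r + a)\<^sup>2 \<le> 1"
      using r assms unfolding t_def by (simp add: divide_simps power_mono)
    then have "8 * a * s^3 * (t / (r + a)\<^sup>2) \<le> 8 * a * s^3 * 1"
      using assms st by (intro mult_left_mono) auto
    moreover have "2 * a / (r + a)\<^sup>2 * (s^4 - 4 * s^3 * t) = 2 * a * s^4 / (r + a)\<^sup>2 - 8 * a * s^3 * (t / (r + a)\<^sup>2)"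
      by (simp add: algebra_simps diff_divide_distrib)
    moreover have "s^4 = R^8" "s^3 = R^6" by (simp_all add: s_def flip: power_mult)
    ultimately show "?g r \<le> G' r" unfolding G'_def s_def[symmetric] t_def[symmetric] by simp
  qed
  also have "\<dots> < 0"
  proof -
    \<comment> \<open>In units of \<open>R^8\<close>: the polynomial part at R gives 4 - 16/3 + 2 =
      2/3, the term \<open>2 * a * R^8 / (a + a)\<close> subtracts 1, and
      \<open>R \<ge> 100 * a\<close> keeps the two errors below 2/100 and 8/100. The other terms at
      a have the favourable sign.\<close>
    have "2 * a / (R + a) \<le> 2/100" using assms by (simp add: divide_simps)
    then have "2 * a / (R + a) * R^8 \<le> 2/100 * R^8" using R by (intro mult_right_mono) auto
    moreover have "8 * a * R^7 \<le> 8 * (R / 100) * R^7" using assms R by (intro mult_right_mono) auto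
    moreover have "8 * (R / 100) * R^7 = 8/100 * R^8" by (simp add: eval_nat_numeral)
    moreover have "0 < R^8" using R by simp
    moreover have "0 \<le> 4 * R^4 * a^4 - 16/3 * R\<^sup>2 * a^6"
    proof -
      have "(100 * a)\<^sup>2 \<le> R\<^sup>2" using assms by (intro power_mono) auto
      then have "10000 * a\<^sup>2 \<le> R\<^sup>2" by (simp add: power_mult_distrib)
      then have "4/3 * a\<^sup>2 \<le> R\<^sup>2" using zero_le_power2[of a] by linarith
      then have "0 \<le> 4 * R\<^sup>2 * a^4 * (R\<^sup>2 - 4/3 * a\<^sup>2)"
        by (intro mult_nonneg_nonneg) auto
      then show ?thesis by (simp add: eval_nat_numeral algebra_simps)
    qed
    moreover have "0 \<le> 2 * a^8" "0 \<le> 8 * a * R^6 * a" using assms by auto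
    moreover have "2 * a * R^8 / (a + a) = R^8" using assms by simp
    moreover have "4 * R^4 * R^4 = 4 * R^8" "16/3 * R\<^sup>2 * R^6 = 16/3 * R^8" "8 * a * R^6 * R = 8 * a * R^7"
      by (simp_all add: eval_nat_numeral)
    moreover have "G R - G a = (4 * R^4 * R^4 - 16/3 * R\<^sup>2 * R^6 + 2 * R^8 + 2 * a / (R + a) * R^8 + 8 * a * R^6 * R)
       - ((4 * R^4 * a^4 - 16/3 * R\<^sup>2 * a^6) + 2 * a^8 + 2 * a * R^8 / (a + a) + 8 * a * R^6 * a)"
      unfolding G_def by simp
    ultimately show ?thesis by linarith
  qed
  finally show ?thesis .
qed

lemma indexQ_bump_neg:
  assumes m: "m > 0" "R \<ge> 50 * m" and c: "c \<noteq> 0"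
  shows "indexQ m R (\<lambda>p. c * bump R p) < 0"
proof -
  define a where "a = m/2"
  have a: "a > 0" "R \<ge> 100 * a" "m = 2 * a" using m by (auto simp: a_def)
  let ?g = "\<lambda>r. 16 * r^3 * (R\<^sup>2 - r\<^sup>2)\<^sup>2 - 2 * a / (r + a)\<^sup>2 * (R\<^sup>2 - r\<^sup>2)^4"
  have pdf: "pd (\<lambda>p. c * bump R p) k = (\<lambda>p. - 4 * c * (R\<^sup>2 - (norm p)\<^sup>2) * p$k)" for k
    by (rule ext) (rule pd_bump)
  have bp: "bump R (polar r \<theta>) = (R\<^sup>2 - r\<^sup>2)\<^sup>2" for r \<theta>
    using norm_vec2_sq[of "polar r \<theta>"] by (simp add: bump_def)
  have "indexQ m R (\<lambda>p. c * bump R p) = integral {m/2..R} (\<lambda>r. integral {0..2*pi} (\<lambda>\<theta>.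
     r * ((pd (\<lambda>p. c * bump R p) 1 (polar r \<theta>))\<^sup>2 + (pd (\<lambda>p. c * bump R p) 2 (polar r \<theta>))\<^sup>2)
       - m / (r + m/2)\<^sup>2 * (c * bump R (polar r \<theta>))\<^sup>2))"
  proof (rule indexQ_polar[of m R UNIV])
    show "continuous_on UNIV (\<lambda>p. c * bump R p)"
      unfolding bump_def by (intro continuous_intros)
    show "continuous_on UNIV (pd (\<lambda>p. c * bump R p) k)" for k
      unfolding pdf by (intro continuous_intros)
  qed (use m in auto)
  also have "\<dots> = integral {a..R} (\<lambda>r. integral {0..2*pi} (\<lambda>\<theta>. c\<^sup>2 * ?g r))"
  proof -
    have "r * ((pd (\<lambda>p. c * bump R p) 1 (polar r \<theta>))\<^sup>2 + (pd (\<lambda>p. c * bump R p) 2 (polar r \<theta>))\<^sup>2)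
       - m / (r + m/2)\<^sup>2 * (c * bump R (polar r \<theta>))\<^sup>2 = c\<^sup>2 * ?g r" for r \<theta>
    proof -
      define D where "D = R\<^sup>2 - r\<^sup>2"
      have "(pd (\<lambda>p. c * bump R p) 1 (polar r \<theta>))\<^sup>2 + (pd (\<lambda>p. c * bump R p) 2 (polar r \<theta>))\<^sup>2
          = 16 * c\<^sup>2 * D\<^sup>2 * (r\<^sup>2 * ((cos \<theta>)\<^sup>2 + (sin \<theta>)\<^sup>2))"
        unfolding pdf norm_polar power2_abs polar_nth D_def[symmetric] distrib_left power_mult_distrib by simp
      then have "(pd (\<lambda>p. c * bump R p) 1 (polar r \<theta>))\<^sup>2 + (pd (\<lambda>p. c * bump R p) 2 (polar r \<theta>))\<^sup>2
          = 16 * c\<^sup>2 * D\<^sup>2 * r\<^sup>2" by simp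
      then show ?thesis
        unfolding bp D_def[symmetric] a(3)
        by (simp add: power_mult_distrib algebra_simps eval_nat_numeral)
    qed
    then show ?thesis by (simp add: a_def)
  qed
  also have "\<dots> = 2 * pi * c\<^sup>2 * integral {a..R} ?g"
  proof -
    have "integral {0..2*pi} (\<lambda>\<theta>. c\<^sup>2 * ?g r) = 2 * pi * c\<^sup>2 * ?g r" for r
      using integral_const_real[of "c\<^sup>2 * ?g r" 0 "2 * pi"] by simp
    then show ?thesis by (simp only: integral_mult_right)
  qed
  also have "\<dots> < 0"
    using radial_form_bump_neg[OF a(1,2)] c by (intro mult_pos_neg) auto
  finally show ?thesis .
qed

subsection \<open>The Morse index\<close>

lemma pd_linear_combination:
  fixes u v :: "real^2 \<Rightarrow> real"
  assumes "u differentiable (at p)" "v differentiable (at p)"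
  shows "pd (\<lambda>p. c * u p + d * v p) k p = c * pd u k p + d * pd v k p"
proof -
  let ?w = "\<lambda>p. c * u p + d * v p"
  have "((\<lambda>p. c * u p + d * v p) has_derivative
     (\<lambda>h. c * (pd u 1 p * h$1 + pd u 2 p * h$2) + d * (pd v 1 p * h$1 + pd v 2 p * h$2))) (at p)"
    by (intro has_derivative_add has_derivative_mult_right has_derivative_pd assms)
  moreover from this have "(?w has_derivative (\<lambda>h. pd ?w 1 p * h$1 + pd ?w 2 p * h$2)) (at p)"
    by (intro has_derivative_pd) (auto simp: differentiable_def)
  ultimately have eq: "(\<lambda>h::real^2. pd ?w 1 p * h$1 + pd ?w 2 p * h$2) =
     (\<lambda>h. c * (pd u 1 p * h$1 + pd u 2 p * h$2) + d * (pd v 1 p * h$1 + pd v 2 p * h$2))"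
    by (rule has_derivative_unique[rotated])
  show ?thesis
    using fun_cong[OF eq, of "axis k 1"] exhaust_2[of k] by (auto simp: axis_def)
qed

text \<open>One linear functional on two coefficients has a nonzero kernel vector. This matches the
  definition of the index, which tests coefficient vectors.\<close>

lemma admissible_pair_indexQ_nonneg:
  assumes m: "m > 0" "m \<le> R" and "admissible m R u" "admissible m R v"
  obtains c d where "c \<noteq> 0 \<or> d \<noteq> 0" "0 \<le> indexQ m R (\<lambda>p. c * u p + d * v p)"
proof -
  obtain S T where S: "plane_dom m R \<subseteq> S" "smooth_on S u" and T: "plane_dom m R \<subseteq> T" "smooth_on T v"
    using assms unfolding admissible_def by blast
  have du: "u differentiable (at p)" and dpu: "pd u k differentiable (at p)" if "p \<in> S" for p k
    using S(2) that unfolding smooth_on_def by (metis pdl.simps)+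
  have dv: "v differentiable (at p)" and dpv: "pd v k differentiable (at p)" if "p \<in> T" for p k
    using T(2) that unfolding smooth_on_def by (metis pdl.simps)+
  \<comment> \<open>The mean over the circle of radius \<open>m\<close>, twice the horizon radius, is the single linear
    constraint under which the form becomes nonnegative.\<close>
  define L where "L w = integral {0..2*pi} (\<lambda>\<theta>. w (polar m \<theta>))" for w :: "real^2 \<Rightarrow> real"
  obtain c d where cd: "c \<noteq> 0 \<or> d \<noteq> 0" "c * L u + d * L v = 0"
  proof (cases "L u = 0")
    case True
    then show ?thesis using that[of 1 0] by simp
  next
    case False
    then show ?thesis using that[of "L v" "- L u"] by simp
  qed
  let ?w = "\<lambda>p. c * u p + d * v p"
  have circ: "polar m \<theta> \<in> S" "polar m \<theta> \<in> T" for \<theta>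
    using S(1) T(1) m by (auto simp: plane_dom_def)
  have "0 \<le> indexQ m R ?w"
  \<comment> \<open>Each function is smooth on its own open set, so the combination is treated on
    the intersection.\<close>
  proof (rule indexQ_nonneg[OF m, of "S \<inter> T"])
    show "?w differentiable (at p)" if "p \<in> S \<inter> T" for p
      using that du dv by (intro derivative_intros) auto
    show "continuous_on (S \<inter> T) (pd ?w k)" for k
    proof (rule continuous_on_eq)
      show "continuous_on (S \<inter> T) (\<lambda>p. c * pd u k p + d * pd v k p)"
        by (intro continuous_intros continuous_at_imp_continuous_on ballI differentiable_imp_continuous_within dpu dpv) auto
    qed (use du dv in \<open>auto simp: pd_linear_combination\<close>)
    show "?w p = 0" if "norm p = R" for p
      using that assms(3,4) unfolding admissible_def by simp
    have int: "(\<lambda>\<theta>. h (polar m \<theta>)) integrable_on {0..2*pi}"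
      if "continuous_on X h" "\<And>\<theta>. polar m \<theta> \<in> X" for h :: "real^2 \<Rightarrow> real" and X
      by (rule integrable_continuous_interval, rule continuous_on_compose2[OF that(1)])
        (use that(2) in \<open>auto intro!: continuous_intros\<close>)
    have "continuous_on S u" "continuous_on T v"
      using du dv by (meson continuous_at_imp_continuous_on differentiable_imp_continuous_within)+
    then have "integral {0..2*pi} (\<lambda>\<theta>. ?w (polar m \<theta>)) = c * L u + d * L v"
      unfolding L_def using circ int
      by (subst integral_add) (auto intro!: integrable_on_mult_right)
    then show "integral {0..2*pi} (\<lambda>\<theta>. ?w (polar m \<theta>)) = 0" using cd by simp
  qed (use S T in auto)
  then show ?thesis using that cd by blast
qed

lemma morse_index_R_eq_1:
  assumes m: "m > 0" "R \<ge> 50 * m"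
  shows "morse_index_R m R = 1"
proof -
  let ?K = "{enat k | k. \<exists>us :: nat \<Rightarrow> real^2 \<Rightarrow> real.
      (\<forall>i<k. admissible m R (us i)) \<and>
      (\<forall>c :: nat \<Rightarrow> real. (\<exists>i<k. c i \<noteq> 0) \<longrightarrow>
          indexQ m R (\<lambda>p. \<Sum>i<k. c i * us i p) < 0)}"
  have "\<exists>us :: nat \<Rightarrow> real^2 \<Rightarrow> real. (\<forall>i<1. admissible m R (us i)) \<and>
      (\<forall>c :: nat \<Rightarrow> real. (\<exists>i<1. c i \<noteq> 0) \<longrightarrow> indexQ m R (\<lambda>p. \<Sum>i<1. c i * us i p) < 0)"
    using admissible_bump[of m R 1] indexQ_bump_neg[OF m] by (intro exI[of _ "\<lambda>_. bump R"]) simp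
  then have "enat 1 \<in> ?K" by blast
  then have "1 \<le> Sup ?K" unfolding one_enat_def by (rule Sup_upper)
  moreover have "k \<le> 1" if us: "\<forall>i<k. admissible m R (us i)"
    and neg: "\<forall>c :: nat \<Rightarrow> real. (\<exists>i<k. c i \<noteq> 0) \<longrightarrow> indexQ m R (\<lambda>p. \<Sum>i<k. c i * us i p) < 0"
    for k and us :: "nat \<Rightarrow> real^2 \<Rightarrow> real"
  proof (rule ccontr)
    assume "\<not> k \<le> 1"
    then have k: "0 < k" "1 < k" by auto
    have "m \<le> R" using m by auto
    then obtain c d where cd: "c \<noteq> 0 \<or> d \<noteq> 0" "0 \<le> indexQ m R (\<lambda>p. c * us 0 p + d * us 1 p)"
      using admissible_pair_indexQ_nonneg[of m R "us 0" "us 1"] m us k by blast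
    \<comment> \<open>Padding the pair with zeros gives a coefficient vector for the whole family,
      against its negativity.\<close>
    define e where "e i = (if i = 0 then c else if i = 1 then d else 0)" for i :: nat
    have eq: "(\<Sum>i<k. e i * us i p) = c * us 0 p + d * us 1 p" for p
    proof -
      have "(\<Sum>i<k. e i * us i p) = (\<Sum>i\<in>{0,1}. e i * us i p)"
        by (rule sum.mono_neutral_right) (use k in \<open>auto simp: e_def\<close>)
      then show ?thesis by (simp add: e_def)
    qed
    have "\<exists>i<k. e i \<noteq> 0"
      using cd(1) k unfolding e_def by (cases "c = 0") (auto intro: exI[of _ 0] exI[of _ 1])
    then have "indexQ m R (\<lambda>p. \<Sum>i<k. e i * us i p) < 0" using neg by blast
    then show False using cd(2) unfolding eq by simp
  qed
  then have "Sup ?K \<le> 1" by (intro Sup_least) (auto simp: one_enat_def)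
  ultimately show ?thesis unfolding morse_index_R_def by (rule antisym[rotated])
qed

theorem theorem1p1:
  fixes m :: real
  assumes "m > 0"
  shows "((\<lambda>R. morse_index_R m R) \<longlongrightarrow> (1 :: enat)) at_top"
\<comment> \<open>The index is already constant from R = 50 m on, so convergence is
  immediate.\<close>
proof (rule tendsto_eventually)
  show "\<forall>\<^sub>F R in at_top. morse_index_R m R = 1"
    using eventually_ge_at_top[of "50 * m"] by (rule eventually_mono) (rule morse_index_R_eq_1[OF assms])
qed

end
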